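(* Let $d\ge 2$ and let $G_d(x,t)=\frac{1}{(4\pi t)^{d/2}}e^{-|x|^2/(4t)}$ for $x\in\mathbb{R}^d$, $t>0$. There is a constant $C_d>0$ such that for every $0<\epsilon<0.1$ and every $T\ge 1000\delta>0$ there exist positive integers $$N_1\le C_d\log\frac{T}{\delta}\left(\log\frac1\epsilon+\log\log\frac{T}{\delta}\right),\qquad N_2\le C_d\log\frac1\epsilon\left(\log\frac{T}{\delta}+\log\frac1\epsilon\right),$$ positive reals $\tilde w_j,\lambda_j$ ($j=1,\dots,N_2$), and complex numbers $w_k$ and $s_k\in\mathbb{C}\setminus(-\infty,0]$ ($k=-N_1,\dots,N_1$) such that $$\tilde G_d(x,t)=\sum_{j=1}^{N_2}\tilde w_j e^{-\lambda_j t}\sum_{k=-N_1}^{N_1}w_k e^{s_k t}e^{-\sqrt{s_k}|x|}$$ satisfies $|G_d(x,t)-\tilde G_d(x,t)|<\frac{\epsilon}{t^{d/2}}$ for all $x\in\mathbb{R}^d$ and all $t\in[\delta,T]$.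
   Context: $|x|$ is the Euclidean norm on $\mathbb{R}^d$; $\sqrt{s}$ denotes the principal branch of the square root on $\mathbb{C}\setminus(-\infty,0]$. *)

theory Defs
  imports "HOL-Analysis.Analysis"
begin

definition heat_kernel :: "'a::euclidean_space \<Rightarrow> real \<Rightarrow> real" where
  "heat_kernel x t = exp (- (norm x)\<^sup>2 / (4 * t)) / (4 * pi * t) powr (real DIM('a) / 2)"

definition approx_kernel ::
  "nat \<Rightarrow> nat \<Rightarrow> (nat \<Rightarrow> real) \<Rightarrow> (nat \<Rightarrow> real) \<Rightarrow> (int \<Rightarrow> complex) \<Rightarrow> (int \<Rightarrow> complex)
    \<Rightarrow> 'a::euclidean_space \<Rightarrow> real \<Rightarrow> complex" where
  "approx_kernel N1 N2 wt lam w s x t =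
     (\<Sum>j=1..N2. complex_of_real (wt j * exp (- lam j * t)) *
        (\<Sum>k=-int N1..int N1. w k * exp (s k * complex_of_real t) *
              exp (- csqrt (s k) * complex_of_real (norm x))))"

end

theory Submission
  imports Defs "HOL-Complex_Analysis.Complex_Analysis" "HOL-Real_Asymp.Real_Asymp"
begin

text \<open>
  The factor \<open>t^(-(d-1)/2)\<close> and the one-dimensional kernel \<open>t^(-1/2) exp(-r^2/(4t))\<close> of \<open>G_d\<close> are
  approximated separately, with errors that are relative to \<open>t^(-(d-1)/2)\<close> and \<open>t^(-1/2)\<close> and uniform
  on \<open>[\<delta>, T]\<close>, by truncated trapezoidal rules for integrals over the real line of functions
  analytic in a strip. With \<open>\<beta> = (d-1)/2\<close>, the first one is the integral of \<open>exp(\<beta> u - t exp u)\<close>,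
  which is a multiple of \<open>t^(-\<beta>)\<close>; its rule has positive weights. The second one is the
  integral of \<open>exp(t z^2 - r z)\<close> where \<open>z\<close>, the square root of the Laplace variable \<open>s\<close>, runs
  through the hyperbola \<open>z(u) = \<mu> cosh(u + 3 \<pi> \<i> / 8)\<close> in the right half-plane. The choice
  \<open>\<mu>^2 = K/T\<close>, where \<open>K\<close> is comparable to \<open>log(1/\<epsilon>)\<close>, keeps the truncation point proportional to
  \<open>log(T/\<delta>)\<close> at the price of a factor \<open>exp(K/4)\<close>, which a step width proportional to \<open>1/K\<close> absorbs.
  The exact values of the two integrals are multiples of the targets by positive constants
  (a Gamma value and the square root of \<open>\<pi>\<close>) that need not be known, since the weights can be
  divided by them.
\<close>

section \<open>The trapezoidal rule for functions analytic in a strip\<close>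

text \<open>If \<open>f z = 0\<close>, the singularity is removable and the simple-pole formula does
  not apply directly. Then \<open>f + 1\<close> is nonzero at \<open>z\<close>, and the formula for
  \<open>(f + 1) / g\<close> minus the one for \<open>1 / g\<close> gives the claim. This covers
  integrands that vanish at a node.\<close>

lemma residue_over_simple_zero:
  fixes f g :: "complex \<Rightarrow> complex"
  assumes f: "f holomorphic_on S" and g: "g holomorphic_on S" and S: "open S" "connected S" "z \<in> S"
    and g': "(g has_field_derivative g') (at z)" "g' \<noteq> 0"
    and zero: "g z = 0" "\<And>w. w \<in> S \<Longrightarrow> g w = 0 \<Longrightarrow> w = z"
  shows "residue (\<lambda>w. f w / g w) z = f z / g'"
proof (cases "f z = 0")
  case False
  then show ?thesis
    by (intro residue_simple_pole_deriv[OF f g S g'(1)] zero g'(2))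
next
  case True
  have "residue (\<lambda>w. (f w + 1) / g w) z = (f z + 1) / g'"
    using True by (intro residue_simple_pole_deriv[OF _ g S g'(1)] holomorphic_intros f zero g'(2)) auto
  moreover have "residue (\<lambda>w. 1 / g w) z = 1 / g'"
    by (intro residue_simple_pole_deriv[OF _ g S g'(1)] holomorphic_intros zero g'(2)) auto
  moreover have "residue (\<lambda>w. (f w + 1) / g w - 1 / g w) z
      = residue (\<lambda>w. (f w + 1) / g w) z - residue (\<lambda>w. 1 / g w) z"
    using zero(2) by (intro residue_diff[OF S(1) S(3)] holomorphic_intros
        holomorphic_on_subset[OF f] holomorphic_on_subset[OF g]) auto
  ultimately show ?thesis
    by (simp add: add_divide_distrib)
qed

text \<open>On the convex set \<open>S\<close> the integrand has a primitive, so the integral is an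
  increment of it, and the mean value inequality compares that increment with the one of
  \<open>P\<close>. Giving the majorant \<open>p\<close> through an antiderivative \<open>P\<close>
  replaces real integrals by increments from here on.\<close>

lemma contour_integral_horizontal_bound:
  fixes g :: "complex \<Rightarrow> complex"
  assumes "g holomorphic_on S" "open S" "convex S" and "A \<le> B"
    and S: "\<And>x. x \<in> {A..B} \<Longrightarrow> Complex x b \<in> S"
    and bound: "\<And>x. x \<in> {A..B} \<Longrightarrow> cmod (g (Complex x b)) \<le> p x"
    and P: "\<And>x. (P has_real_derivative p x) (at x)"
  shows "cmod (contour_integral (linepath (Complex A b) (Complex B b)) g) \<le> P B - P A"
proof (cases "A = B")
  case False
  obtain G where G: "\<And>z. z \<in> S \<Longrightarrow> (G has_field_derivative g z) (at z within S)"
    using holomorphic_convex_primitive'[OF \<open>convex S\<close> \<open>open S\<close> \<open>g holomorphic_on S\<close>] by blast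
  have "closed_segment (Complex A b) (Complex B b) \<subseteq> S"
    using S assms(4) by (auto simp: closed_segment_same_Im closed_segment_eq_real_ivl) (metis complex.collapse)
  then have "contour_integral (linepath (Complex A b) (Complex B b)) g = G (Complex B b) - G (Complex A b)"
    using contour_integral_primitive[OF G, of "linepath (Complex A b) (Complex B b)"]
    by (intro contour_integral_unique) auto
  moreover have "cmod (G (Complex B b) - G (Complex A b)) \<le> P B - P A"
  proof -
    have deriv: "((\<lambda>x. G (Complex x b)) has_vector_derivative g (Complex x b)) (at x)" if x: "x \<in> {A..B}" for x
    proof -
      have *: "at (Complex x b) within S = at (Complex x b)"
        using S[OF x] \<open>open S\<close> by (rule at_within_open)
      have "(G has_field_derivative g (Complex x b)) (at (Complex x b))"
        using G[OF S[OF x]] unfolding * .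
      then have "((\<lambda>z. G (z + \<i> * of_real b)) has_field_derivative g (Complex x b)) (at (of_real x))"
        by (simp only: DERIV_shift Complex_eq)
      then show ?thesis
        unfolding Complex_eq by (rule has_vector_derivative_real_field)
    qed
    have "A < B" using False assms(4) by simp
    moreover have "continuous_on {A..B} (\<lambda>x. G (Complex x b))"
      by (rule continuous_at_imp_continuous_on) (use deriv has_vector_derivative_continuous in blast)
    moreover have "continuous_on {A..B} P"
      by (rule continuous_at_imp_continuous_on) (use P DERIV_isCont in blast)
    ultimately show ?thesis
      by (rule differentiable_bound_general[of A B "\<lambda>x. G (Complex x b)" P "\<lambda>x. g (Complex x b)" p])
        (use deriv P bound in \<open>simp_all add: has_real_derivative_iff_has_vector_derivative\<close>)
  qed
  ultimately show ?thesis by simp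
qed simp

lemma holomorphic_if_primitive:
  assumes F: "\<And>z. (F has_field_derivative f z) (at z)"
  shows "f holomorphic_on UNIV"
proof -
  have "F holomorphic_on UNIV"
    using F by (meson field_differentiable_at_within field_differentiable_def holomorphic_on_def)
  then have "deriv F holomorphic_on UNIV" by (rule holomorphic_deriv) simp
  moreover have "deriv F = f" using DERIV_imp_deriv[OF F] by blast
  ultimately show ?thesis by simp
qed

lemma primitive_increment_bound:
  assumes F: "\<And>z. (F has_field_derivative f z) (at z)" and "A \<le> B"
    and bound: "\<And>x. x \<in> {A..B} \<Longrightarrow> cmod (f (of_real x)) \<le> p x"
    and P: "\<And>x. (P has_real_derivative p x) (at x)"
  shows "cmod (F (of_real B) - F (of_real A)) \<le> P B - P A"
proof -
  have "f holomorphic_on UNIV" using F by (rule holomorphic_if_primitive)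
  then have "cmod (contour_integral (linepath (Complex A 0) (Complex B 0)) f) \<le> P B - P A"
    using bound by (intro contour_integral_horizontal_bound[OF _ _ _ assms(2) _ _ P, of f UNIV]) (auto simp: Complex_eq)
  moreover have "contour_integral (linepath (Complex A 0) (Complex B 0)) f = F (Complex B 0) - F (Complex A 0)"
    using contour_integral_primitive[of UNIV F f "linepath (Complex A 0) (Complex B 0)"] F
    by (intro contour_integral_unique) auto
  ultimately show ?thesis by (simp add: Complex_eq)
qed

section \<open>The trapezoidal sum as a contour integral, and its error\<close>

lemma exp_2pi_i_eq_1_iff:
  assumes "h > 0"
  shows "exp (2 * of_real pi * \<i> * z / of_real h) = 1 \<longleftrightarrow> (\<exists>k::int. z = of_int k * of_real h)"
proof -
  have "Re (2 * of_real pi * \<i> * z / of_real h) = - 2 * pi * Im z / h"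
    "Im (2 * of_real pi * \<i> * z / of_real h) = 2 * pi * Re z / h" by simp_all
  then have "exp (2 * of_real pi * \<i> * z / of_real h) = 1
      \<longleftrightarrow> Im z = 0 \<and> (\<exists>k::int. Re z = of_int k * h)"
    using assms by (auto simp: exp_eq_1 field_simps)
  then show ?thesis
    by (auto simp: complex_eq_iff)
qed

text \<open>The function \<open>1 / (exp (2 * pi * \<i> * z / h) - 1)\<close> has simple poles
  exactly at the multiples of \<open>h\<close>, each with residue
  \<open>h / (2 * pi * \<i>)\<close>, so this is the residue theorem. As \<open>B\<close> is a
  half-integer multiple of \<open>h\<close>, exactly the nodes \<open>-N..N\<close> are
  enclosed.\<close>

lemma trapezoidal_sum_eq_contour_integral:
  assumes f: "f holomorphic_on UNIV" and "h > 0" "a > 0" and B: "B = (real N + 1/2) * h"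
  shows "of_real h * (\<Sum>k=-int N..int N. f (of_int k * of_real h)) =
    contour_integral (rectpath (Complex (-B) (-a)) (Complex B a))
      (\<lambda>z. f z / (exp (2 * of_real pi * \<i> * z / of_real h) - 1))"
proof -
  define E where "E = (\<lambda>z. exp (2 * of_real pi * \<i> * z / of_real h) - 1)"
  define node where "node = (\<lambda>k::int. of_int k * complex_of_real h)"
  \<comment> \<open>\<open>W\<close> is the abscissa of the first omitted node: the open strip
    \<open>S\<close> contains the nodes \<open>-N..N\<close> and no others, and still contains the
    rectangle.\<close>
  define W where "W = (real N + 1) * h"
  define S where "S = {z. - W < Re z \<and> Re z < W}"
  define pts where "pts = node ` {-int N..int N}"
  let ?R = "rectpath (Complex (-B) (-a)) (Complex B a)"
  have "B > 0" using B \<open>h > 0\<close> by simp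
  have S: "open S" "convex S"
  proof -
    have "S = {z. Re z > - W} \<inter> {z. Re z < W}"
      by (auto simp: S_def)
    then show "open S" "convex S"
      by (auto intro!: open_Int convex_Int open_halfspace_Re_gt open_halfspace_Re_lt
          convex_halfspace_Re_gt convex_halfspace_Re_lt)
  qed
  have E_zero: "E z = 0 \<longleftrightarrow> z \<in> range node" for z
    using exp_2pi_i_eq_1_iff[OF \<open>h > 0\<close>] by (auto simp: E_def node_def)
  have S_node: "node k \<in> S \<longleftrightarrow> k \<in> {-int N..int N}" for k
  proof -
    have "node k \<in> S \<longleftrightarrow> (- real N - 1) * h < real_of_int k * h \<and> real_of_int k * h < (real N + 1) * h"
      by (auto simp: S_def node_def W_def algebra_simps)
    also have "\<dots> \<longleftrightarrow> - real N - 1 < real_of_int k \<and> real_of_int k < real N + 1"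
      using \<open>h > 0\<close> by (simp only: mult_less_cancel_right_pos)
    also have "\<dots> \<longleftrightarrow> k \<in> {-int N..int N}"
      by auto
    finally show ?thesis .
  qed
  have E_holo: "E holomorphic_on T" for T
    unfolding E_def by (intro holomorphic_intros) (use \<open>h > 0\<close> in auto)
  have inj: "inj node"
    using \<open>h > 0\<close> by (auto simp: inj_def node_def)
  have path: "path_image ?R \<subseteq> S - pts"
  proof -
    have "path_image ?R = {z. Re z \<in> {-B, B} \<and> Im z \<in> {-a..a}} \<union> {z. Im z \<in> {-a, a} \<and> Re z \<in> {-B..B}}"
      using \<open>a > 0\<close> \<open>B > 0\<close> by (simp add: path_image_rectpath)
    moreover have "B < W" unfolding W_def using \<open>h > 0\<close> B by simp
    moreover have "node k \<noteq> z" if "Re z \<in> {-B, B}" for k z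
    proof -
      \<comment> \<open>Parity: \<open>B / h = N + 1/2\<close>, and the even number
        \<open>2 * k\<close> is neither \<open>2 * N + 1\<close> nor its negative.\<close>
      have "real_of_int (2 * k) \<noteq> real_of_int (2 * int N + 1)"
        "real_of_int (2 * k) \<noteq> real_of_int (- 2 * int N - 1)"
        unfolding of_int_eq_iff by presburger+
      then have "real_of_int k \<noteq> real N + 1 / 2" "real_of_int k \<noteq> - real N - 1 / 2"
        by auto
      moreover have "- B = (- real N - 1 / 2) * h" by (simp add: B algebra_simps)
      ultimately have "real_of_int k * h \<noteq> B" "real_of_int k * h \<noteq> - B"
        using \<open>h > 0\<close> unfolding B by (auto simp del: mult_minus_left)
      then show ?thesis using that by (auto simp: node_def)
    qed
    moreover have "node k \<noteq> z" if "Im z \<in> {-a, a}" for k z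
      using that \<open>a > 0\<close> by (auto simp: node_def)
    ultimately show ?thesis
      unfolding pts_def S_def using \<open>a > 0\<close> \<open>B > 0\<close> by fastforce
  qed
  have "contour_integral ?R (\<lambda>z. f z / E z)
      = 2 * pi * \<i> * (\<Sum>p\<in>pts. winding_number ?R p * residue (\<lambda>z. f z / E z) p)"
  proof (rule Residue_theorem[OF S(1) convex_connected[OF S(2)] _ _ _ _ path])
    show "(\<lambda>z. f z / E z) holomorphic_on S - pts"
      using E_zero S_node by (intro holomorphic_intros holomorphic_on_subset[OF f] E_holo) (auto simp: pts_def)
    show "\<forall>z. z \<notin> S \<longrightarrow> winding_number ?R z = 0"
      using path by (auto intro!: winding_number_zero_outside[OF _ S(2)])
  qed (auto simp: pts_def)
  also have "(\<Sum>p\<in>pts. winding_number ?R p * residue (\<lambda>z. f z / E z) p)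
      = (\<Sum>p\<in>pts. f p * (of_real h / (2 * pi * \<i>)))"
  proof (rule sum.cong)
    fix p assume "p \<in> pts"
    then obtain k where k: "p = node k" "k \<in> {-int N..int N}" by (auto simp: pts_def)
    have "\<bar>real_of_int k\<bar> < real N + 1/2" using k(2) by auto
    then have "\<bar>real_of_int k * h\<bar> < B" using \<open>h > 0\<close> by (simp add: B abs_mult)
    then have "winding_number ?R p = 1"
      using \<open>a > 0\<close> by (intro winding_number_rectpath) (auto simp: in_box_complex_iff k node_def)
    moreover have "residue (\<lambda>z. f z / E z) p = f p / (2 * pi * \<i> / of_real h)"
    proof (rule residue_over_simple_zero)
      \<comment> \<open>Distinct nodes are at least \<open>h\<close> apart, so this open ball
        contains no zero of \<open>E\<close> other than \<open>p\<close>.\<close>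
      let ?T = "ball p h"
      show "f holomorphic_on ?T" by (rule holomorphic_on_subset[OF f]) simp
      have "E p = 0" using E_zero k by auto
      then show "E p = 0" .
      then have "exp (2 * of_real pi * \<i> * p / of_real h) = 1" by (simp add: E_def)
      then show "(E has_field_derivative 2 * pi * \<i> / of_real h) (at p)"
        unfolding E_def using \<open>h > 0\<close> by (auto intro!: derivative_eq_intros)
      show "w = p" if w: "w \<in> ?T" "E w = 0" for w
      proof -
        obtain j where j: "w = node j" using w E_zero by auto
        have "norm (of_int (j - k) * complex_of_real h) < h"
          using w by (simp add: j k node_def dist_norm norm_minus_commute algebra_simps)
        then have "\<bar>real_of_int (j - k)\<bar> * h < 1 * h"
          using \<open>h > 0\<close> unfolding norm_mult norm_of_int by simp
        then have "\<bar>real_of_int (j - k)\<bar> < 1"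
          using \<open>h > 0\<close> by (subst (asm) mult_less_cancel_right_pos) auto
        then have "j = k" by linarith
        then show ?thesis by (simp add: j k)
      qed
    qed (use \<open>h > 0\<close> E_holo in auto)
    ultimately show "winding_number ?R p * residue (\<lambda>z. f z / E z) p = f p * (of_real h / (2 * pi * \<i>))"
      by (simp add: field_simps)
  qed simp
  also have "(\<Sum>p\<in>pts. f p * (of_real h / (2 * pi * \<i>)))
      = (\<Sum>k=-int N..int N. f (node k)) * (of_real h / (2 * pi * \<i>))"
    unfolding pts_def using inj
    by (subst sum.reindex) (auto simp: o_def inj_on_def sum_distrib_right sum_divide_distrib)
  finally show ?thesis by (simp add: E_def node_def)
qed

text \<open>Each term of the bound belongs to a part of the boundary. The two horizontal sides
  contribute \<open>V / (exp (2 * pi * a / h) - 1)\<close> each. The two vertical sides have length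
  \<open>2 * a\<close> and integrand at most \<open>\<eta> * M\<close>, and joining the upper
  corners to the real axis costs \<open>\<eta> * M * a\<close> twice, which makes
  \<open>6 * a * \<eta> * M\<close>. The real line beyond \<open>B\<close> costs
  \<open>2 * \<eta> * V\<close>. The integral over the line is encoded as the limit \<open>I\<close>
  of increments of the primitive \<open>F\<close>.\<close>

lemma trapezoidal_rule_error:
  fixes F f :: "complex \<Rightarrow> complex" and p P :: "real \<Rightarrow> real"
  assumes F: "\<And>z. (F has_field_derivative f z) (at z)"
    and "h > 0" "a > 0" "\<eta> \<ge> 0" and B: "B = (real N + 1/2) * h"
    and P: "\<And>x. (P has_real_derivative p x) (at x)" "\<And>x. 0 \<le> P x" "\<And>x. P x \<le> V" "\<And>x. p x \<le> M"
    and bound: "\<And>x y. \<bar>y\<bar> \<le> a \<Longrightarrow> cmod (f (Complex x y)) \<le> p x"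
    and tail: "\<And>x y. \<bar>y\<bar> \<le> a \<Longrightarrow> B \<le> \<bar>x\<bar> \<Longrightarrow> cmod (f (Complex x y)) \<le> \<eta> * p x"
    and I: "(\<lambda>n. F (of_nat n) - F (- of_nat n)) \<longlonglongrightarrow> I"
  shows "cmod (of_real h * (\<Sum>k=-int N..int N. f (of_int k * of_real h)) - I)
    \<le> 2 * V / (exp (2 * pi * a / h) - 1) + 6 * a * \<eta> * M + 2 * \<eta> * V"
proof -
  have f: "f holomorphic_on UNIV" using F by (rule holomorphic_if_primitive)
  define E where "E = (\<lambda>z. exp (2 * of_real pi * \<i> * z / of_real h))"
  define g where "g = (\<lambda>z. f z / (E z - 1))"
  define Q where "Q = exp (2 * pi * a / h)"
  define b1 b2 b3 b4 where "b1 = Complex (-B) (-a)" and "b2 = Complex B (-a)"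
    and "b3 = Complex B a" and "b4 = Complex (-B) a"
  have "B > 0" using B \<open>h > 0\<close> by simp
  have "Q > 1" unfolding Q_def using \<open>h > 0\<close> \<open>a > 0\<close> by simp
  have E_eq: "E z = 1 \<longleftrightarrow> (\<exists>k::int. z = of_int k * of_real h)" for z
    unfolding E_def by (rule exp_2pi_i_eq_1_iff[OF \<open>h > 0\<close>])
  have E_holo: "E holomorphic_on T" for T
    unfolding E_def by (intro holomorphic_intros) (use \<open>h > 0\<close> in auto)
  have norm_E: "cmod (E z) = exp (- 2 * pi * Im z / h)" for z
    by (simp add: E_def)
  have Q_neg: "exp (- 2 * pi * a / h) = 1 / Q"
    by (simp add: Q_def exp_minus inverse_eq_divide)
  text \<open>The vertical sides pass midway between nodes, where \<open>E\<close> is a negative real. On the lower side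
    \<open>E\<close> is large; on the upper side it is small, and there \<open>g = g E - f\<close>, where the part \<open>- f\<close>
    produces the integral of \<open>f\<close>.\<close>
  have E_vertical: "1 \<le> cmod (E z - 1)" if "\<bar>Re z\<bar> = B" for z
  proof -
    have "2 * pi * B / h = pi + 2 * pi * real N"
      using \<open>h > 0\<close> by (simp add: B field_simps)
    moreover have "Re z = B \<or> Re z = - B" using that by linarith
    ultimately have "2 * pi * Re z / h = pi + 2 * pi * real N \<or> 2 * pi * Re z / h = - (pi + 2 * pi * real N)"
      by fastforce
    then have "cos (2 * pi * Re z / h) = - 1"
      using cos_2npi[of N] by (auto simp: cos_add mult_ac simp flip: minus_add_distrib)
    then have "Re (E z) = - exp (- 2 * pi * Im z / h)"
      by (simp add: E_def Re_exp)
    then have "Re (E z - 1) \<le> - 1" by simp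
    then show ?thesis using abs_Re_le_cmod[of "E z - 1"] by linarith
  qed
  have E_bottom: "Q - 1 \<le> cmod (E z - 1)" if "Im z = - a" for z
    using norm_triangle_ineq2[of "E z" 1] that by (simp add: norm_E Q_def)
  have E_top: "1 - 1 / Q \<le> cmod (E z - 1)" if "Im z = a" for z
    using norm_triangle_ineq2[of 1 "E z"] that Q_neg by (simp add: norm_E norm_minus_commute)
  have seg: "closed_segment b1 b2 = {z. Im z = - a \<and> \<bar>Re z\<bar> \<le> B}"
    "closed_segment b4 b3 = {z. Im z = a \<and> \<bar>Re z\<bar> \<le> B}"
    "closed_segment b2 b3 = {z. Re z = B \<and> \<bar>Im z\<bar> \<le> a}"
    "closed_segment b4 b1 = {z. Re z = - B \<and> \<bar>Im z\<bar> \<le> a}"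
    using \<open>B > 0\<close> \<open>a > 0\<close> unfolding b1_def b2_def b3_def b4_def
    by (auto simp: closed_segment_same_Re closed_segment_same_Im closed_segment_eq_real_ivl)
  have g_holo: "g holomorphic_on {z. E z \<noteq> 1}"
    unfolding g_def by (intro holomorphic_intros holomorphic_on_subset[OF f] E_holo) auto
  have nonzero: "E z \<noteq> 1" if "\<bar>Re z\<bar> = B \<or> \<bar>Im z\<bar> = a" for z
  proof -
    have "1 - 1 / Q > 0" "Q - 1 > 0" using \<open>Q > 1\<close> by simp_all
    then show ?thesis
      using that E_vertical[of z] E_bottom[of z] E_top[of z] by (auto simp: abs_if split: if_splits)
  qed
  have g_cont: "continuous_on T g" if "\<And>z. z \<in> T \<Longrightarrow> \<bar>Re z\<bar> = B \<or> \<bar>Im z\<bar> = a" for T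
    using that nonzero by (intro holomorphic_on_imp_continuous_on holomorphic_on_subset[OF g_holo]) auto
  have g_int: "g contour_integrable_on linepath b1 b2" "g contour_integrable_on linepath b2 b3"
    "g contour_integrable_on linepath b4 b3" "g contour_integrable_on linepath b3 b4"
    "g contour_integrable_on linepath b4 b1"
    using \<open>a > 0\<close> \<open>B > 0\<close>
    by (intro contour_integrable_continuous_linepath g_cont;
        auto simp: seg closed_segment_commute[of b3 b4])+
  have "of_real h * (\<Sum>k=-int N..int N. f (of_int k * of_real h)) = contour_integral (rectpath b1 b3) g"
    using trapezoidal_sum_eq_contour_integral[OF f \<open>h > 0\<close> \<open>a > 0\<close> B]
    by (simp add: b1_def b3_def g_def E_def)
  also have "\<dots> = contour_integral (linepath b1 b2) g + contour_integral (linepath b2 b3) g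
      + contour_integral (linepath b3 b4) g + contour_integral (linepath b4 b1) g"
    using g_int by (simp add: rectpath_def Let_def b1_def b2_def b3_def b4_def contour_integrable_join)
  also have "contour_integral (linepath b3 b4) g = - contour_integral (linepath b4 b3) g"
    using \<open>a > 0\<close> by (intro contour_integral_reverse_linepath g_cont) (auto simp: seg closed_segment_commute[of b3 b4])
  also have "contour_integral (linepath b4 b3) g
      = contour_integral (linepath b4 b3) (\<lambda>z. g z * E z) - (F b3 - F b4)"
  proof -
    have "contour_integral (linepath b4 b3) g = contour_integral (linepath b4 b3) (\<lambda>z. g z * E z - f z)"
    proof (rule contour_integral_cong)
      fix z assume "z \<in> path_image (linepath b4 b3)"
      then have "E z \<noteq> 1" using nonzero \<open>a > 0\<close> by (auto simp: seg)
      then show "g z = g z * E z - f z" by (simp add: g_def field_simps)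
    qed simp
    also have "\<dots> = contour_integral (linepath b4 b3) (\<lambda>z. g z * E z) - contour_integral (linepath b4 b3) f"
    proof (rule contour_integral_diff)
      show "(\<lambda>z. g z * E z) contour_integrable_on linepath b4 b3"
        using \<open>a > 0\<close> by (intro contour_integrable_continuous_linepath continuous_intros g_cont
            holomorphic_on_imp_continuous_on[OF E_holo]) (auto simp: seg)
      show "f contour_integrable_on linepath b4 b3"
        by (intro contour_integrable_continuous_linepath holomorphic_on_imp_continuous_on holomorphic_on_subset[OF f]) simp
    qed
    also have "contour_integral (linepath b4 b3) f = F b3 - F b4"
      using contour_integral_primitive[of UNIV F f "linepath b4 b3"] F
      by (intro contour_integral_unique) auto
    finally show ?thesis .
  qed
  finally have sum_eq: "of_real h * (\<Sum>k=-int N..int N. f (of_int k * of_real h))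
    = contour_integral (linepath b1 b2) g + contour_integral (linepath b2 b3) g
      - contour_integral (linepath b4 b3) (\<lambda>z. g z * E z) + (F b3 - F b4) + contour_integral (linepath b4 b1) g"
    by simp

  have p_nonneg: "p x \<ge> 0" for x
    using order_trans[OF norm_ge_zero bound[of 0 x]] \<open>a > 0\<close> by simp
  have PV: "P B - P (-B) \<le> V" using P(2)[of "-B"] P(3)[of B] by linarith
  have bottom: "cmod (contour_integral (linepath b1 b2) g) \<le> V / (Q - 1)"
  proof -
    have "cmod (contour_integral (linepath b1 b2) g) \<le> P B / (Q - 1) - P (-B) / (Q - 1)"
      unfolding b1_def b2_def
    proof (rule contour_integral_horizontal_bound[where S = "{z. Im z < 0}" and p = "\<lambda>x. p x / (Q - 1)"])
      show "g holomorphic_on {z. Im z < 0}"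
        using E_eq by (intro holomorphic_on_subset[OF g_holo]) auto
      show "cmod (g (Complex x (- a))) \<le> p x / (Q - 1)" for x
        using bound[of "-a" x] p_nonneg[of x] E_bottom[of "Complex x (-a)"] \<open>a > 0\<close> \<open>Q > 1\<close>
        unfolding g_def norm_divide by (intro frac_le) auto
    qed (use \<open>a > 0\<close> \<open>B > 0\<close> P(1) in \<open>auto intro: open_halfspace_Im_lt convex_halfspace_Im_lt DERIV_cdivide\<close>)
    also have "\<dots> = (P B - P (-B)) / (Q - 1)" by (simp add: diff_divide_distrib)
    also have "\<dots> \<le> V / (Q - 1)" using PV \<open>Q > 1\<close> by (intro divide_right_mono) auto
    finally show ?thesis .
  qed
  have top: "cmod (contour_integral (linepath b4 b3) (\<lambda>z. g z * E z)) \<le> V / (Q - 1)"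
  proof -
    have "cmod (contour_integral (linepath b4 b3) (\<lambda>z. g z * E z)) \<le> P B / (Q - 1) - P (-B) / (Q - 1)"
      unfolding b3_def b4_def
    proof (rule contour_integral_horizontal_bound[where S = "{z. Im z > 0}" and p = "\<lambda>x. p x / (Q - 1)"])
      show "(\<lambda>z. g z * E z) holomorphic_on {z. Im z > 0}"
        using E_eq by (intro holomorphic_intros E_holo holomorphic_on_subset[OF g_holo]) auto
      show "cmod (g (Complex x a) * E (Complex x a)) \<le> p x / (Q - 1)" for x
      proof -
        \<comment> \<open>Here \<open>(1 / Q) / (1 - 1 / Q) = 1 / (Q - 1)\<close>, so the top side
          is as small as the bottom one.\<close>
        have "cmod (g (Complex x a) * E (Complex x a))
            = cmod (f (Complex x a)) * (1 / Q) / cmod (E (Complex x a) - 1)"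
          using Q_neg by (simp add: g_def norm_mult norm_divide norm_E)
        also have "\<dots> \<le> p x * (1 / Q) / (1 - 1 / Q)"
          using bound[of a x] E_top[of "Complex x a"] \<open>a > 0\<close> \<open>Q > 1\<close>
          by (intro frac_le mult_right_mono) (use p_nonneg[of x] in auto)
        also have "\<dots> = p x / (Q - 1)" using \<open>Q > 1\<close> by (simp add: field_simps)
        finally show ?thesis .
      qed
    qed (use \<open>a > 0\<close> \<open>B > 0\<close> P(1) in \<open>auto intro: open_halfspace_Im_gt convex_halfspace_Im_gt DERIV_cdivide\<close>)
    also have "\<dots> = (P B - P (-B)) / (Q - 1)" by (simp add: diff_divide_distrib)
    also have "\<dots> \<le> V / (Q - 1)" using PV \<open>Q > 1\<close> by (intro divide_right_mono) auto
    finally show ?thesis .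
  qed
  have "\<eta> * M \<ge> 0"
    using order_trans[OF p_nonneg P(4)] \<open>\<eta> \<ge> 0\<close> by simp
  have f_vertical: "cmod (f z) \<le> \<eta> * M" if "\<bar>Re z\<bar> = B" "\<bar>Im z\<bar> \<le> a" for z
    using tail[of "Im z" "Re z"] mult_left_mono[OF P(4)[of "Re z"] \<open>\<eta> \<ge> 0\<close>] that by auto
  have g_vertical: "cmod (g z) \<le> \<eta> * M" if "\<bar>Re z\<bar> = B" "\<bar>Im z\<bar> \<le> a" for z
  proof -
    have "cmod (g z) \<le> cmod (f z) / 1"
      unfolding g_def norm_divide using E_vertical[OF that(1)] by (intro frac_le) auto
    then show ?thesis using f_vertical[OF that] by simp
  qed
  have right: "cmod (contour_integral (linepath b2 b3) g) \<le> \<eta> * M * (2 * a)"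
  proof -
    have "cmod (b3 - b2) = 2 * a"
      using \<open>a > 0\<close> by (simp add: b2_def b3_def cmod_def real_sqrt_mult)
    then show ?thesis
      using has_contour_integral_bound_linepath[OF has_contour_integral_integral[OF g_int(2)] \<open>\<eta> * M \<ge> 0\<close>]
        g_vertical \<open>B > 0\<close> by (auto simp: seg)
  qed
  have left: "cmod (contour_integral (linepath b4 b1) g) \<le> \<eta> * M * (2 * a)"
  proof -
    have "cmod (b1 - b4) = 2 * a"
      using \<open>a > 0\<close> by (simp add: b1_def b4_def cmod_def real_sqrt_mult)
    then show ?thesis
      using has_contour_integral_bound_linepath[OF has_contour_integral_integral[OF g_int(5)] \<open>\<eta> * M \<ge> 0\<close>]
        g_vertical \<open>B > 0\<close> by (auto simp: seg)
  qed
  \<comment> \<open>The part \<open>- f\<close> of the upper side contributes the increment of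
    \<open>F\<close> between the upper corners; moving both corners down to the real axis makes it
    comparable with \<open>I\<close>.\<close>
  have F_vertical: "cmod (F (Complex x a) - F (of_real x)) \<le> \<eta> * M * a" if "\<bar>x\<bar> = B" for x
  proof -
    have "(f has_contour_integral (F (Complex x a) - F (Complex x 0))) (linepath (Complex x 0) (Complex x a))"
      using contour_integral_primitive[of UNIV F f "linepath (Complex x 0) (Complex x a)"] F by auto
    then have "cmod (F (Complex x a) - F (Complex x 0)) \<le> \<eta> * M * cmod (Complex x a - Complex x 0)"
      using \<open>\<eta> * M \<ge> 0\<close>
      by (rule has_contour_integral_bound_linepath)
        (use \<open>a > 0\<close> that in \<open>auto simp: closed_segment_same_Re closed_segment_eq_real_ivl intro!: f_vertical\<close>)
    then show ?thesis using \<open>a > 0\<close> by (simp add: cmod_def Complex_eq)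
  qed
  have "cmod (I - (F (of_real B) - F (of_real (-B)))) \<le> 2 * \<eta> * V"
  proof (rule Lim_norm_ubound)
    show "(\<lambda>n. F (of_nat n) - F (- of_nat n) - (F (of_real B) - F (of_real (-B))))
      \<longlonglongrightarrow> I - (F (of_real B) - F (of_real (-B)))"
      by (intro tendsto_intros I)
    have "cmod (F (of_nat n) - F (- of_nat n) - (F (of_real B) - F (of_real (-B)))) \<le> 2 * \<eta> * V"
      if "real n \<ge> B" for n
    proof -
      \<comment> \<open>Beyond \<open>B\<close> the majorant improves to \<open>\<eta> * p\<close>,
        with antiderivative \<open>\<eta> * P\<close>. Each tail therefore costs at most
        \<open>\<eta> * V\<close> for every \<open>n\<close>, and the bound passes to the
        limit.\<close>
      have *: "((\<lambda>x. \<eta> * P x) has_real_derivative \<eta> * p x) (at x)" for x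
        using P(1) by (rule DERIV_cmult)
      have "cmod (F (of_real (real n)) - F (of_real B)) \<le> \<eta> * P (real n) - \<eta> * P B"
        using that tail[of 0] \<open>B > 0\<close> \<open>a > 0\<close>
        by (intro primitive_increment_bound[OF F _ _ *]) (auto simp: Complex_eq)
      moreover have "cmod (F (of_real (-B)) - F (of_real (- real n))) \<le> \<eta> * P (-B) - \<eta> * P (- real n)"
        using that tail[of 0] \<open>B > 0\<close> \<open>a > 0\<close>
        by (intro primitive_increment_bound[OF F _ _ *]) (auto simp: Complex_eq)
      moreover have "\<eta> * P (real n) \<le> \<eta> * V" "\<eta> * P (-B) \<le> \<eta> * V" "\<eta> * P B \<ge> 0" "\<eta> * P (- real n) \<ge> 0"
        using P \<open>\<eta> \<ge> 0\<close> by (auto intro: mult_left_mono)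
      moreover have "F (of_nat n) - F (- of_nat n) - (F (of_real B) - F (of_real (-B)))
          = (F (of_real (real n)) - F (of_real B)) + (F (of_real (-B)) - F (of_real (- real n)))" by simp
      ultimately show ?thesis
        using norm_triangle_ineq[of "F (of_real (real n)) - F (of_real B)" "F (of_real (-B)) - F (of_real (- real n))"]
        by (simp only:)
    qed
    then show "\<forall>\<^sub>F n in sequentially. cmod (F (of_nat n) - F (- of_nat n) - (F (of_real B) - F (of_real (-B)))) \<le> 2 * \<eta> * V"
      using eventually_sequentiallyI[of "nat \<lceil>B\<rceil>"] by (metis (no_types, lifting) le_nat_iff nat_ceiling_le_eq of_nat_ceiling order_trans)
  qed simp
  moreover have diff_mono: "cmod (x - y) \<le> r + s" if "cmod x \<le> r" "cmod y \<le> s" for x y r s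
    using that norm_triangle_ineq4[of x y] by linarith
  \<comment> \<open>The error is split into horizontal sides, vertical sides, the two corner
    corrections and the truncation of the line.\<close>
  moreover have "of_real h * (\<Sum>k=-int N..int N. f (of_int k * of_real h)) - I
    = contour_integral (linepath b1 b2) g - contour_integral (linepath b4 b3) (\<lambda>z. g z * E z)
      + contour_integral (linepath b2 b3) g + contour_integral (linepath b4 b1) g
      + ((F b3 - F (of_real B)) - (F b4 - F (of_real (-B)))) - (I - (F (of_real B) - F (of_real (-B))))"
    unfolding sum_eq by (simp add: algebra_simps)
  moreover have "cmod (F b3 - F (of_real B)) \<le> \<eta> * M * a" "cmod (F b4 - F (of_real (-B))) \<le> \<eta> * M * a"
    using F_vertical[of B] F_vertical[of "-B"] \<open>B > 0\<close> by (auto simp: b3_def b4_def)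
  ultimately have "cmod (of_real h * (\<Sum>k=-int N..int N. f (of_int k * of_real h)) - I)
    \<le> V / (Q - 1) + V / (Q - 1) + \<eta> * M * (2 * a) + \<eta> * M * (2 * a) + (\<eta> * M * a + \<eta> * M * a) + 2 * \<eta> * V"
    using bottom top left right
    by (simp only:) (intro norm_triangle_mono diff_mono; assumption)
  then show ?thesis by (simp add: Q_def algebra_simps)
qed

text \<open>The step \<open>h = pi * a / K\<close> makes
  \<open>exp (2 * pi * a / h) = exp (2 * K)\<close>. A majorant of total mass
  \<open>V * exp K\<close> thus still gives an error of order \<open>exp (- K)\<close> on the
  horizontal sides, and the tail factor \<open>exp (- (4 * K))\<close> outweighs the growth
  \<open>exp (3 * K)\<close> allowed for \<open>p\<close>.\<close>

lemma trapezoidal_rule_exponential_error: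
  fixes F f :: "complex \<Rightarrow> complex" and p P :: "real \<Rightarrow> real"
  assumes F: "\<And>z. (F has_field_derivative f z) (at z)"
    and "a > 0" "K \<ge> 1" and h: "h = pi * a / K" and B: "B = (real N + 1/2) * h"
    and P: "\<And>x. (P has_real_derivative p x) (at x)" "\<And>x. 0 \<le> P x" "\<And>x. P x \<le> V * exp K"
      "\<And>x. p x \<le> M * exp (3 * K)"
    and bound: "\<And>x y. \<bar>y\<bar> \<le> a \<Longrightarrow> cmod (f (Complex x y)) \<le> p x"
    and tail: "\<And>x y. \<bar>y\<bar> \<le> a \<Longrightarrow> B \<le> \<bar>x\<bar> \<Longrightarrow> cmod (f (Complex x y)) \<le> exp (- (4 * K)) * p x"
    and I: "(\<lambda>n. F (of_nat n) - F (- of_nat n)) \<longlonglongrightarrow> I"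
  shows "cmod (of_real h * (\<Sum>k=-int N..int N. f (of_int k * of_real h)) - I) \<le> (6 * V + 6 * a * M) * exp (- K)"
proof -
  have "h > 0" using h assms(2,3) by simp
  have "0 \<le> V * exp K" using order_trans[OF P(2,3)] .
  then have "V \<ge> 0" by (simp add: zero_le_mult_iff)
  have "exp (2 * K) \<ge> 2" using exp_ge_add_one_self[of "2 * K"] \<open>K \<ge> 1\<close> by linarith
  have "cmod (of_real h * (\<Sum>k=-int N..int N. f (of_int k * of_real h)) - I)
      \<le> 2 * (V * exp K) / (exp (2 * pi * a / h) - 1) + 6 * a * exp (- (4 * K)) * (M * exp (3 * K))
        + 2 * exp (- (4 * K)) * (V * exp K)"
    by (rule trapezoidal_rule_error[OF F \<open>h > 0\<close> \<open>a > 0\<close> _ B P bound tail I]) auto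
  also have "2 * pi * a / h = 2 * K" using \<open>a > 0\<close> \<open>K \<ge> 1\<close> by (simp add: h)
  also have "2 * (V * exp K) / (exp (2 * K) - 1) \<le> 2 * (V * exp K) / (exp (2 * K) / 2)"
    using \<open>exp (2 * K) \<ge> 2\<close> \<open>V \<ge> 0\<close> by (intro frac_le) auto
  also have "\<dots> = 4 * V * exp (- K)"
    by (simp add: exp_minus field_simps mult_exp_exp)
  also have "6 * a * exp (- (4 * K)) * (M * exp (3 * K)) = 6 * a * M * exp (- K)"
    by (simp add: mult.assoc mult.left_commute[of "exp _" M] flip: exp_add)
  also have "2 * exp (- (4 * K)) * (V * exp K) = 2 * V * exp (- (3 * K))"
    by (simp add: mult.assoc mult.left_commute[of "exp _" V] flip: exp_add)
  also have "\<dots> \<le> 2 * V * exp (- K)"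
    using \<open>V \<ge> 0\<close> \<open>K \<ge> 1\<close> by (intro mult_left_mono) auto
  finally show ?thesis by (simp add: algebra_simps)
qed

section \<open>Limits at infinity of primitives of positive functions\<close>

lemma bounded_mono_tendsto_at_top:
  fixes Q :: "real \<Rightarrow> real"
  assumes "mono Q" "bdd_above (range Q)"
  shows "(Q \<longlongrightarrow> Sup (range Q)) at_top"
proof (rule order_tendstoI)
  fix y assume "y < Sup (range Q)"
  then obtain x where "y < Q x" using less_cSup_iff[of "range Q" y] assms(2) by auto
  then show "\<forall>\<^sub>F x in at_top. y < Q x"
    unfolding eventually_at_top_linorder using monoD[OF assms(1)] by (meson order_less_le_trans)
next
  fix y assume "Sup (range Q) < y"
  then show "\<forall>\<^sub>F x in at_top. Q x < y"
    by (intro always_eventually) (meson assms(2) cSup_upper order_le_less_trans rangeI)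
qed

text \<open>On the real axis the imaginary part of \<open>G\<close> is constant and the real part
  strictly increasing. Domination by \<open>p\<close>, whose antiderivative is bounded, keeps the
  real part bounded, so both limits exist. Their difference \<open>c\<close> is the integral of
  \<open>q\<close> over the line.\<close>

lemma positive_primitive_limits:
  fixes G g :: "complex \<Rightarrow> complex" and q p P :: "real \<Rightarrow> real"
  assumes G: "\<And>z. (G has_field_derivative g z) (at z)"
    and q: "\<And>x. g (of_real x) = of_real (q x)" "\<And>x. 0 < q x" "\<And>x. q x \<le> p x"
    and P: "\<And>x. (P has_real_derivative p x) (at x)" "\<And>x. \<bar>P x\<bar> \<le> V"
  obtains c l u where "c > 0" "u - l = complex_of_real c"
    "((\<lambda>x. G (of_real x)) \<longlongrightarrow> u) at_top" "((\<lambda>x. G (of_real x)) \<longlongrightarrow> l) at_bot"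
proof -
  define Q where "Q = (\<lambda>x. Re (G (of_real x)))"
  have vd: "((\<lambda>x. G (of_real x)) has_vector_derivative of_real (q x)) (at x)" for x
    using has_vector_derivative_real_field[OF G] q(1) by simp
  have Q': "(Q has_real_derivative q x) (at x)" for x
    using bounded_linear.has_vector_derivative[OF bounded_linear_Re vd]
    unfolding Q_def by (simp add: has_real_derivative_iff_has_vector_derivative)
  have "((\<lambda>x. Im (G (of_real x))) has_real_derivative 0) (at x)" for x
    using bounded_linear.has_vector_derivative[OF bounded_linear_Im vd]
    by (simp add: has_real_derivative_iff_has_vector_derivative)
  then obtain k where "\<And>x. Im (G (of_real x)) = k"
    by (metis DERIV_isconst_all)
  then have G_eq: "G (of_real x) = of_real (Q x) + \<i> * of_real k" for x
    by (simp add: Q_def complex_eq_iff)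
  have strict: "Q x < Q y" if "x < y" for x y
    using that by (rule DERIV_pos_imp_increasing) (use Q' q(2) in blast)
  have "mono Q" using strict by (intro monoI) (metis less_eq_real_def)
  \<comment> \<open>Because \<open>q \<le> p\<close>, increments of \<open>Q\<close> are at most
    those of \<open>P\<close>, hence at most \<open>2 * V\<close>.\<close>
  have PQ: "P x - Q x \<le> P y - Q y" if "x \<le> y" for x y
  proof (rule DERIV_nonneg_imp_nondecreasing[OF that])
    show "\<exists>d. ((\<lambda>x. P x - Q x) has_real_derivative d) (at z) \<and> 0 \<le> d" for z
      using DERIV_diff[OF P(1) Q'] q(3)[of z] by (intro exI[of _ "p z - q z"]) auto
  qed
  have "\<bar>Q x - Q 0\<bar> \<le> 2 * V" for x
    using PQ[of 0 x] PQ[of x 0] monoD[OF \<open>mono Q\<close>, of 0 x] monoD[OF \<open>mono Q\<close>, of x 0] P(2)[of 0] P(2)[of x]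
    by (cases "0 \<le> x") auto
  then have bd: "Q x \<le> Q 0 + 2 * V" "- Q x \<le> 2 * V - Q 0" for x
    by (simp_all add: abs_le_iff algebra_simps)
  \<comment> \<open>The limit at minus infinity comes from the reflected function
    \<open>- Q (- x)\<close>, which is again nondecreasing.\<close>
  define u l where "u = Sup (range Q)" and "l = - Sup (range (\<lambda>x. - Q (- x)))"
  have u: "(Q \<longlongrightarrow> u) at_top"
    unfolding u_def by (intro bounded_mono_tendsto_at_top \<open>mono Q\<close> bdd_aboveI2[OF bd(1)])
  have "((\<lambda>x. - Q (- x)) \<longlongrightarrow> - l) at_top"
    unfolding l_def minus_minus using monoD[OF \<open>mono Q\<close>]
    by (intro bounded_mono_tendsto_at_top bdd_aboveI2[OF bd(2)]) (auto intro: monoI)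
  then have "((\<lambda>x. Q (- x)) \<longlongrightarrow> l) at_top"
    by (rule tendsto_minus_cancel)
  then have l: "(Q \<longlongrightarrow> l) at_bot"
    by (simp add: filterlim_at_bot_mirror)
  have "l \<le> Q 0"
    using l by (rule tendsto_upperbound) (auto intro!: eventually_at_bot_linorderI[of 0] monoD[OF \<open>mono Q\<close>])
  also have "Q 0 < Q 1" by (rule strict) simp
  also have "Q 1 \<le> u"
    using u by (rule tendsto_lowerbound) (auto intro!: eventually_at_top_linorderI[of 1] monoD[OF \<open>mono Q\<close>])
  finally have "u - l > 0" by simp
  then show ?thesis
  proof (rule that)
    show "((\<lambda>x. G (of_real x)) \<longlongrightarrow> of_real u + \<i> * of_real k) at_top"
      "((\<lambda>x. G (of_real x)) \<longlongrightarrow> of_real l + \<i> * of_real k) at_bot"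
      unfolding G_eq by (intro tendsto_intros u l)+
  qed simp
qed

section \<open>The one-dimensional heat kernel\<close>

lemma cosh_Complex: "cosh (Complex x y) = Complex (cosh x * cos y) (sinh x * sin y)"
  by (simp add: cosh_field_def sinh_field_def complex_eq_iff Re_exp Im_exp algebra_simps add_divide_distrib diff_divide_distrib)

lemma norm_sinh_le: "cmod (sinh w) \<le> cosh (Re w)"
proof -
  have "cmod (sinh w) = cmod (exp w - exp (- w)) / 2"
    by (simp add: sinh_field_def norm_divide)
  also have "\<dots> \<le> (cmod (exp w) + cmod (exp (- w))) / 2"
    by (intro divide_right_mono norm_triangle_ineq4) simp
  finally show ?thesis by (simp add: cosh_field_def)
qed

text \<open>From \<open>cosh^2 = 1 + sinh^2\<close>, \<open>Re (z^2) = \<mu>^2 * ((cos \<phi>)^2 -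
  (sinh x)^2 * (1 - 2 * (cos \<phi>)^2))\<close>, and \<open>(cos \<phi>)^2 \<le> 1/4\<close> leaves
  the stated exponent. Since \<open>Re z \<ge> 0\<close>, the factor \<open>exp (- z * r)\<close>
  has modulus at most 1, so the bound is uniform in \<open>r\<close>.\<close>

lemma hyperbola_integrand_bound:
  fixes r t \<mu> x \<phi> :: real
  assumes "0 \<le> cos \<phi>" "cos \<phi> \<le> 1/2" and nonneg: "0 \<le> r" "0 \<le> t" "0 \<le> \<mu>"
  defines "z \<equiv> of_real \<mu> * cosh (Complex x \<phi>)"
  shows "cmod (exp (z\<^sup>2 * of_real t - z * of_real r) * (of_real \<mu> * sinh (Complex x \<phi>)))
    \<le> \<mu> * cosh x * exp (\<mu>\<^sup>2 * t * (1/4 - (sinh x)\<^sup>2 / 2))"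
proof -
  have c: "(cos \<phi>)\<^sup>2 \<le> 1/4" using power_mono[OF assms(2,1), of 2] by (simp add: power2_eq_square)
  have "Re (z\<^sup>2) = \<mu>\<^sup>2 * ((cosh x)\<^sup>2 * (cos \<phi>)\<^sup>2 - (sinh x)\<^sup>2 * (sin \<phi>)\<^sup>2)"
    by (simp add: z_def cosh_Complex Re_power2 power_mult_distrib algebra_simps)
  also have "\<dots> = \<mu>\<^sup>2 * ((cos \<phi>)\<^sup>2 - (sinh x)\<^sup>2 * (1 - 2 * (cos \<phi>)\<^sup>2))"
    by (simp add: cosh_square_eq sin_squared_eq algebra_simps)
  also have "\<dots> \<le> \<mu>\<^sup>2 * (1/4 - (sinh x)\<^sup>2 * (1/2))"
    using c by (intro mult_left_mono diff_mono) auto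
  finally have "t * Re (z\<^sup>2) \<le> t * (\<mu>\<^sup>2 * (1/4 - (sinh x)\<^sup>2 * (1/2)))"
    using nonneg by (intro mult_left_mono)
  moreover have "r * Re z \<ge> 0"
    using assms(1) nonneg by (simp add: z_def cosh_Complex)
  ultimately have "Re (z\<^sup>2 * of_real t - z * of_real r) \<le> \<mu>\<^sup>2 * t * (1/4 - (sinh x)\<^sup>2 / 2)"
    by (simp add: algebra_simps)
  then have "exp (Re (z\<^sup>2 * of_real t - z * of_real r)) * (\<mu> * cmod (sinh (Complex x \<phi>)))
      \<le> exp (\<mu>\<^sup>2 * t * (1/4 - (sinh x)\<^sup>2 / 2)) * (\<mu> * cosh x)"
    using norm_sinh_le[of "Complex x \<phi>"] nonneg by (intro mult_mono) auto
  then show ?thesis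
    using nonneg by (simp add: norm_mult mult_ac)
qed

text \<open>The majorant \<open>1 / (1 + x^2)\<close> of the Gaussian, from
  \<open>exp y \<ge> 1 + y\<close>, has the bounded antiderivative \<open>arctan\<close>. The
  constant \<open>c\<close> is the square root of \<open>pi\<close>.\<close>

lemma entire_primitive_exp_minus_square:
  obtains G :: "complex \<Rightarrow> complex" and c :: real and u l
  where "\<And>z. (G has_field_derivative exp (- (z\<^sup>2))) (at z)" "c > 0" "u - l = of_real c"
    "((\<lambda>x. G (of_real x)) \<longlongrightarrow> u) at_top" "((\<lambda>x. G (of_real x)) \<longlongrightarrow> l) at_bot"
proof -
  have "(\<lambda>z::complex. exp (- (z\<^sup>2))) holomorphic_on UNIV"
    by (intro holomorphic_intros)
  then obtain G :: "complex \<Rightarrow> complex" where G: "\<And>z. (G has_field_derivative exp (- (z\<^sup>2))) (at z)"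
    using holomorphic_convex_primitive'[of UNIV "\<lambda>z. exp (- (z\<^sup>2))"] by auto
  have bound: "exp (- (x\<^sup>2)) \<le> inverse (1 + x\<^sup>2)" for x :: real
    using exp_ge_add_one_self[of "x\<^sup>2"] by (simp add: exp_minus add_pos_nonneg le_imp_inverse_le)
  have arctan: "\<bar>arctan x\<bar> \<le> pi" for x
    using arctan_bounded[of x] by auto
  show ?thesis
    by (rule positive_primitive_limits[OF G _ _ bound DERIV_arctan arctan])
      (auto intro: that[OF G] simp: exp_of_real[symmetric])
qed

text \<open>On the vertical segment from \<open>Y\<close> to \<open>Y + \<i> * X\<close> the modulus
  of \<open>exp (- (z^2))\<close> is at most \<open>exp (X^2 - Y^2)\<close>, so the increment of
  \<open>G\<close> along it is at most the quantity assumed to tend to 0. This carries limits from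
  the real axis over to the curve.\<close>

lemma tendsto_along_hyperbola:
  fixes G :: "complex \<Rightarrow> complex" and X Y :: "'a \<Rightarrow> real"
  assumes G: "\<And>z. (G has_field_derivative exp (- (z\<^sup>2))) (at z)"
    and lim: "((\<lambda>x. G (of_real (Y x))) \<longlongrightarrow> l) A"
    and decay: "((\<lambda>x. \<bar>X x\<bar> * exp ((X x)\<^sup>2 - (Y x)\<^sup>2)) \<longlongrightarrow> 0) A"
  shows "((\<lambda>x. G (Complex (Y x) (X x))) \<longlongrightarrow> l) A"
proof -
  have "cmod (G (Complex y x) - G (of_real y)) \<le> \<bar>x\<bar> * exp (x\<^sup>2 - y\<^sup>2)" for x y
  proof -
    have "((\<lambda>z. exp (- (z\<^sup>2))) has_contour_integral (G (Complex y x) - G (Complex y 0)))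
        (linepath (Complex y 0) (Complex y x))"
      using contour_integral_primitive[of UNIV G "\<lambda>z. exp (- (z\<^sup>2))" "linepath (Complex y 0) (Complex y x)"] G by auto
    then have "cmod (G (Complex y x) - G (Complex y 0)) \<le> exp (x\<^sup>2 - y\<^sup>2) * cmod (Complex y x - Complex y 0)"
    proof (rule has_contour_integral_bound_linepath)
      fix z assume "z \<in> closed_segment (Complex y 0) (Complex y x)"
      then have "Re z = y" "\<bar>Im z\<bar> \<le> \<bar>x\<bar>"
        by (auto simp: closed_segment_same_Re closed_segment_eq_real_ivl split: if_splits)
      then show "cmod (exp (- (z\<^sup>2))) \<le> exp (x\<^sup>2 - y\<^sup>2)"
        using abs_le_square_iff[of "Im z" x] by (simp add: Re_power2)
    qed simp
    then show ?thesis by (simp add: cmod_def Complex_eq mult.commute)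
  qed
  then have "((\<lambda>x. G (Complex (Y x) (X x)) - G (of_real (Y x))) \<longlongrightarrow> 0) A"
    by (intro Lim_null_comparison[OF _ decay]) auto
  from tendsto_add[OF this lim] show ?thesis by simp
qed

text \<open>This supplies the decay hypothesis of \<open>tendsto_along_hyperbola\<close> after
  completing the square, with \<open>\<rho> = r / (2 * t)\<close>. As
  \<open>cos \<alpha> \<le> 1/2\<close> and \<open>(sin \<alpha>)^2 \<ge> 3/4\<close>, the
  \<open>sinh^2\<close> terms of the exponent have total coefficient at most
  \<open>t * \<mu>^2 * (1/2 - 3/4)\<close>, which is negative.\<close>

lemma hyperbola_exponent_decay:
  fixes \<mu> \<rho> t \<alpha> :: real
  assumes "\<mu> > 0" "t > 0" "0 \<le> cos \<alpha>" "cos \<alpha> \<le> 1/2"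
  shows "(\<lambda>n. \<bar>sqrt t * (\<mu> * (cosh (real n) * cos \<alpha>) - \<rho>)\<bar> *
    exp ((sqrt t * (\<mu> * (cosh (real n) * cos \<alpha>) - \<rho>))\<^sup>2 - (sqrt t * (\<mu> * (sinh (real n) * sin \<alpha>)))\<^sup>2)) \<longlonglongrightarrow> 0"
proof -
  \<comment> \<open>\<open>m\<close> collects what does not grow: \<open>cosh \<le> 1 + sinh\<close>
    and \<open>cos \<alpha> \<le> 1/2\<close> bound the first coordinate by
    \<open>m + \<mu> * sinh y / 2\<close>, up to the factor \<open>sqrt t\<close>.\<close>
  define m where "m = \<mu> / 2 + \<bar>\<rho>\<bar>"
  have sin2: "(sin \<alpha>)\<^sup>2 \<ge> 3/4"
    using power_mono[OF assms(4,3), of 2] unfolding sin_squared_eq by (simp add: power2_eq_square)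
  have bound: "\<bar>sqrt t * (\<mu> * (cosh y * cos \<alpha>) - \<rho>)\<bar> *
      exp ((sqrt t * (\<mu> * (cosh y * cos \<alpha>) - \<rho>))\<^sup>2 - (sqrt t * (\<mu> * (sinh y * sin \<alpha>)))\<^sup>2)
    \<le> sqrt t * (m + \<mu> * sinh y / 2) * exp (t * (2 * m\<^sup>2 - \<mu>\<^sup>2 * (sinh y)\<^sup>2 / 4))" if "y \<ge> 0" for y
  proof -
    define X where "X = \<mu> * (cosh y * cos \<alpha>) - \<rho>"
    have s: "sinh y \<ge> 0" using that by simp
    have "(cosh y)\<^sup>2 \<le> (1 + sinh y)\<^sup>2" using s by (simp add: cosh_square_eq power2_sum)
    then have ch: "cosh y \<le> 1 + sinh y" by (rule power2_le_imp_le) (use s in simp)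
    have "cosh y * cos \<alpha> \<le> (1 + sinh y) * (1/2)"
      by (rule mult_mono[OF ch]) (use s assms in simp_all)
    then have "\<mu> * (cosh y * cos \<alpha>) \<le> \<mu> * ((1 + sinh y) * (1/2))"
      by (rule mult_left_mono) (use assms in simp)
    moreover have "0 \<le> \<mu> * (cosh y * cos \<alpha>)" using assms by simp
    ultimately have X: "\<bar>X\<bar> \<le> m + \<mu> * sinh y / 2"
      by (auto simp: X_def m_def algebra_simps)
    have "X\<^sup>2 \<le> (m + \<mu> * sinh y / 2)\<^sup>2" using X by (simp add: abs_le_square_iff[symmetric])
    also have "\<dots> \<le> 2 * m\<^sup>2 + 2 * (\<mu> * sinh y / 2)\<^sup>2"
      using sum_squares_bound[of m "\<mu> * sinh y / 2"] by (simp add: power2_sum)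
    finally have "X\<^sup>2 \<le> 2 * m\<^sup>2 + \<mu>\<^sup>2 * (sinh y)\<^sup>2 / 2" by (simp add: power_mult_distrib power_divide)
    moreover have "\<mu>\<^sup>2 * (sinh y)\<^sup>2 * (3/4) \<le> \<mu>\<^sup>2 * (sinh y)\<^sup>2 * (sin \<alpha>)\<^sup>2"
      using sin2 by (intro mult_left_mono) auto
    ultimately have "X\<^sup>2 - (\<mu> * (sinh y * sin \<alpha>))\<^sup>2 \<le> 2 * m\<^sup>2 - \<mu>\<^sup>2 * (sinh y)\<^sup>2 / 4"
      by (simp add: power_mult_distrib)
    then have "t * (X\<^sup>2 - (\<mu> * (sinh y * sin \<alpha>))\<^sup>2) \<le> t * (2 * m\<^sup>2 - \<mu>\<^sup>2 * (sinh y)\<^sup>2 / 4)"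
      using assms by (intro mult_left_mono) auto
    moreover have "(sqrt t * X)\<^sup>2 - (sqrt t * (\<mu> * (sinh y * sin \<alpha>)))\<^sup>2 = t * (X\<^sup>2 - (\<mu> * (sinh y * sin \<alpha>))\<^sup>2)"
      using assms by (simp add: power_mult_distrib right_diff_distrib)
    ultimately show ?thesis
      unfolding X_def[symmetric] using X assms by (intro mult_mono) (auto simp: abs_mult)
  qed
  have "((\<lambda>y. sqrt t * (m + \<mu> * y / 2) * exp (t * (2 * m\<^sup>2 - \<mu>\<^sup>2 * y\<^sup>2 / 4))) \<longlongrightarrow> 0) at_top"
    using assms(1,2) by real_asymp
  moreover have "filterlim (\<lambda>n. sinh (real n)) at_top sequentially"
    by (rule filterlim_compose[OF sinh_real_at_top filterlim_real_sequentially])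
  ultimately have lim: "(\<lambda>n. sqrt t * (m + \<mu> * sinh (real n) / 2) * exp (t * (2 * m\<^sup>2 - \<mu>\<^sup>2 * (sinh (real n))\<^sup>2 / 4)))
      \<longlonglongrightarrow> 0"
    by (rule filterlim_compose)
  show ?thesis
    by (rule tendsto_sandwich[OF _ _ tendsto_const lim]) (auto intro!: always_eventually bound)
qed

text \<open>Completing the square, \<open>t w\<^sup>2 - r w = - v\<^sup>2 - r\<^sup>2/(4t)\<close> with \<open>v = - \<i> \<surd>t (w - r/(2t))\<close>.\<close>
lemma hyperbola_primitive:
  fixes G :: "complex \<Rightarrow> complex" and \<mu> t r \<alpha> :: real
  assumes G: "\<And>z. (G has_field_derivative exp (- (z\<^sup>2))) (at z)"
    and lim: "((\<lambda>x. G (of_real x)) \<longlongrightarrow> u) at_top" "((\<lambda>x. G (of_real x)) \<longlongrightarrow> l) at_bot"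
    and "\<mu> > 0" "t > 0" and \<alpha>: "0 \<le> cos \<alpha>" "cos \<alpha> \<le> 1/2" "sin \<alpha> > 0"
  defines "w \<equiv> \<lambda>z. of_real \<mu> * cosh (z + \<i> * of_real \<alpha>)"
  defines "F \<equiv> \<lambda>z. of_real (exp (- (r\<^sup>2) / (4 * t)) / sqrt t) * \<i> *
    G (- \<i> * of_real (sqrt t) * (w z - of_real (r / (2 * t))))"
  shows "(F has_field_derivative exp ((w z)\<^sup>2 * of_real t - w z * of_real r) * (of_real \<mu> * sinh (z + \<i> * of_real \<alpha>))) (at z)"
    and "(\<lambda>n. F (of_nat n) - F (- of_nat n)) \<longlonglongrightarrow> of_real (exp (- (r\<^sup>2) / (4 * t)) / sqrt t) * \<i> * (u - l)"
proof -
  let ?\<rho> = "r / (2 * t)"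
  let ?v = "\<lambda>z. - \<i> * of_real (sqrt t) * (w z - of_real ?\<rho>)"
  let ?s = "of_real \<mu> * sinh (z + \<i> * of_real \<alpha>)"
  have sq: "complex_of_real (sqrt t) * complex_of_real (sqrt t) = of_real t"
    using \<open>t > 0\<close> by (simp flip: of_real_mult)
  have nz: "complex_of_real (sqrt t) \<noteq> 0" using \<open>t > 0\<close> by simp
  have "(?v has_field_derivative - \<i> * of_real (sqrt t) * ?s) (at z)"
    unfolding w_def by (auto intro!: derivative_eq_intros)
  from DERIV_cmult[OF DERIV_chain2[OF G this]]
  have "(F has_field_derivative of_real (exp (- (r\<^sup>2) / (4 * t)) / sqrt t) * \<i> *
      (exp (- (?v z)\<^sup>2) * (- \<i> * of_real (sqrt t) * ?s))) (at z)"
    unfolding F_def .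
  also have "of_real (exp (- (r\<^sup>2) / (4 * t)) / sqrt t) * \<i> * (exp (- (?v z)\<^sup>2) * (- \<i> * of_real (sqrt t) * ?s))
      = exp (of_real (- (r\<^sup>2) / (4 * t))) * exp (- (?v z)\<^sup>2) * ?s"
    using nz by (simp add: exp_of_real[symmetric] field_simps)
  also have "\<dots> = exp (of_real (- (r\<^sup>2) / (4 * t)) - (?v z)\<^sup>2) * ?s"
    by (simp only: diff_conv_add_uminus exp_add)
  also have "of_real (- (r\<^sup>2) / (4 * t)) - (?v z)\<^sup>2 = (w z)\<^sup>2 * of_real t - w z * of_real r"
  proof -
    have "(?v z)\<^sup>2 = - (of_real t * (w z - of_real ?\<rho>)\<^sup>2)"
      by (simp add: power_mult_distrib power2_eq_square[of "of_real (sqrt t)"] sq)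
    moreover have "of_real t * (w z - of_real ?\<rho>)\<^sup>2
        = (w z)\<^sup>2 * of_real t - w z * of_real r + of_real (r\<^sup>2 / (4 * t))"
      using \<open>t > 0\<close> by (simp add: field_simps power2_eq_square)
    ultimately show ?thesis by simp
  qed
  finally show "(F has_field_derivative exp ((w z)\<^sup>2 * of_real t - w z * of_real r) * ?s) (at z)" .

  \<comment> \<open>The factor \<open>- \<i>\<close> exchanges the coordinates: \<open>Y n\<close>
    is the real and \<open>X n\<close> the imaginary part of the argument of \<open>G\<close> at
    \<open>n\<close>. The upper end of the hyperbola goes to plus infinity, the lower end to minus
    infinity.\<close>
  define X where "X = (\<lambda>n. - (sqrt t * (\<mu> * (cosh (real n) * cos \<alpha>) - ?\<rho>)))"
  define Y where "Y = (\<lambda>n. sqrt t * (\<mu> * (sinh (real n) * sin \<alpha>)))"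
  have "filterlim (\<lambda>n. sinh (real n)) at_top sequentially"
    by (rule filterlim_compose[OF sinh_real_at_top filterlim_real_sequentially])
  then have "filterlim (\<lambda>n. (sqrt t * \<mu> * sin \<alpha>) * sinh (real n)) at_top sequentially"
    by (intro filterlim_tendsto_pos_mult_at_top[OF tendsto_const]) (use \<alpha> \<open>\<mu> > 0\<close> \<open>t > 0\<close> in simp)
  then have Y: "filterlim Y at_top sequentially"
    by (simp add: Y_def mult_ac)
  then have Y': "filterlim (\<lambda>n. - Y n) at_bot sequentially"
    by (simp add: filterlim_uminus_at_bot)
  have decay: "(\<lambda>n. \<bar>X n\<bar> * exp ((X n)\<^sup>2 - (Y n)\<^sup>2)) \<longlonglongrightarrow> 0"
    using hyperbola_exponent_decay[OF \<open>\<mu> > 0\<close> \<open>t > 0\<close> \<alpha>(1,2), of ?\<rho>] by (simp add: X_def Y_def)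
  have w_at: "w (of_nat n) = Complex (\<mu> * (cosh (real n) * cos \<alpha>)) (\<mu> * (sinh (real n) * sin \<alpha>))"
    "w (- of_nat n) = Complex (\<mu> * (cosh (real n) * cos \<alpha>)) (- (\<mu> * (sinh (real n) * sin \<alpha>)))" for n
  proof -
    have "complex_of_nat n + \<i> * of_real \<alpha> = Complex (real n) \<alpha>"
      "- complex_of_nat n + \<i> * of_real \<alpha> = Complex (- real n) \<alpha>" by (simp_all add: complex_eq_iff)
    then show "w (of_nat n) = Complex (\<mu> * (cosh (real n) * cos \<alpha>)) (\<mu> * (sinh (real n) * sin \<alpha>))"
      "w (- of_nat n) = Complex (\<mu> * (cosh (real n) * cos \<alpha>)) (- (\<mu> * (sinh (real n) * sin \<alpha>)))"
      by (simp_all only: w_def cosh_Complex) (simp_all add: complex_eq_iff)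
  qed
  have v_at: "?v (of_nat n) = Complex (Y n) (X n)" "?v (- of_nat n) = Complex (- Y n) (X n)" for n
    unfolding w_at X_def Y_def by (simp_all add: complex_eq_iff)
  have "(\<lambda>n. G (Complex (Y n) (X n))) \<longlonglongrightarrow> u"
    by (rule tendsto_along_hyperbola[OF G filterlim_compose[OF lim(1) Y] decay])
  moreover have "(\<lambda>n. G (Complex (- Y n) (X n))) \<longlonglongrightarrow> l"
    by (rule tendsto_along_hyperbola[OF G filterlim_compose[OF lim(2) Y']]) (use decay in simp)
  ultimately have "(\<lambda>n. of_real (exp (- (r\<^sup>2) / (4 * t)) / sqrt t) * \<i> * (G (Complex (Y n) (X n)) - G (Complex (- Y n) (X n))))
      \<longlonglongrightarrow> of_real (exp (- (r\<^sup>2) / (4 * t)) / sqrt t) * \<i> * (u - l)"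
    by (intro tendsto_intros)
  then show "(\<lambda>n. F (of_nat n) - F (- of_nat n)) \<longlonglongrightarrow> of_real (exp (- (r\<^sup>2) / (4 * t)) / sqrt t) * \<i> * (u - l)"
    unfolding F_def v_at right_diff_distrib[of "of_real (exp (- (r\<^sup>2) / (4 * t)) / sqrt t) * \<i>"] .
qed

text \<open>The step is proportional to \<open>1 / K\<close> and the truncation point at most of
  order \<open>ln (T / \<delta>)\<close>, hence \<open>K * ln (T / \<delta>)\<close> nodes, chosen
  independently of \<open>r\<close> and \<open>t\<close>. The points \<open>z k\<close> are returned
  instead of their squares because \<open>0 < Re (z k)\<close> identifies them as principal
  roots.\<close>

lemma gaussian_exponential_sum:
  "\<exists>C>0. \<forall>K \<delta> T. 1 \<le> K \<and> 0 < \<delta> \<and> \<delta> < T \<and> 1 \<le> ln (T / \<delta>) \<longrightarrow>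
    (\<exists>(N::nat) w z. N > 0 \<and> real N \<le> C * K * ln (T / \<delta>) \<and> (\<forall>k::int. 0 < Re (z k)) \<and>
      (\<forall>r t. 0 \<le> r \<and> \<delta> \<le> t \<and> t \<le> T \<longrightarrow>
        cmod (of_real (exp (- (r\<^sup>2) / (4 * t)) / sqrt t)
          - (\<Sum>k=-int N..int N. w k * exp ((z k)\<^sup>2 * of_real t - z k * of_real r))) \<le> C * exp (- K) / sqrt t))"
proof -
  obtain G :: "complex \<Rightarrow> complex" and c :: real and u l
    where G: "\<And>z. (G has_field_derivative exp (- (z\<^sup>2))) (at z)" and "c > 0" "u - l = of_real c"
      and lim: "((\<lambda>x. G (of_real x)) \<longlongrightarrow> u) at_top" "((\<lambda>x. G (of_real x)) \<longlongrightarrow> l) at_bot"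
    by (rule entire_primitive_exp_minus_square) (rule that)
  \<comment> \<open>\<open>3 * pi / 8\<close> is the middle of the interval from
    \<open>pi / 4\<close> to \<open>pi / 2\<close>; subtracting \<open>pi / 24\<close> gives exactly
    \<open>pi / 3\<close>, where the cosine is \<open>1/2\<close>.\<close>
  define \<alpha> a :: real where "\<alpha> = 3 * pi / 8" and "a = pi / 24"
  text \<open>For \<open>\<bar>y\<bar> \<le> a\<close> the angle \<open>y + \<alpha>\<close> lies strictly between \<open>\<pi>/4\<close> and \<open>\<pi>/2\<close>: the hyperbola stays
    in the right half-plane while \<open>exp (t z\<^sup>2)\<close> decays along it.\<close>
  have angle: "0 \<le> cos (y + \<alpha>)" "cos (y + \<alpha>) \<le> 1/2" if "\<bar>y\<bar> \<le> a" for y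
  proof -
    have y: "pi / 3 \<le> y + \<alpha>" "y + \<alpha> \<le> pi / 2"
      using that pi_gt_zero unfolding \<alpha>_def a_def by linarith+
    then show "0 \<le> cos (y + \<alpha>)" using pi_gt_zero by (intro cos_ge_zero) linarith+
    have "cos (y + \<alpha>) \<le> cos (pi / 3)"
      using y pi_gt_zero by (intro cos_monotone_0_pi_le) linarith+
    then show "cos (y + \<alpha>) \<le> 1/2" by (simp add: cos_60)
  qed
  have a: "0 < a" by (simp add: a_def)
  have cos\<alpha>: "0 < cos \<alpha>" "cos \<alpha> \<le> 1/2"
    using angle[of 0] a by (auto intro!: cos_gt_zero simp: \<alpha>_def)
  have sin\<alpha>: "0 < sin \<alpha>" by (auto intro!: sin_gt_zero simp: \<alpha>_def)
  \<comment> \<open>The first summand is the quadrature error after division by \<open>c\<close>;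
    the other two bound the number of nodes.\<close>
  define C where "C = (12 * pi + 12 * a) / c + 10 / (pi * a) + 1"
  have "C > 0" unfolding C_def using \<open>c > 0\<close> a pi_gt_zero by (intro add_nonneg_pos add_nonneg_nonneg) auto
  have "\<exists>(N::nat) w z. N > 0 \<and> real N \<le> C * K * ln (T / \<delta>) \<and> (\<forall>k::int. 0 < Re (z k)) \<and>
      (\<forall>r t. 0 \<le> r \<and> \<delta> \<le> t \<and> t \<le> T \<longrightarrow>
        cmod (of_real (exp (- (r\<^sup>2) / (4 * t)) / sqrt t)
          - (\<Sum>k=-int N..int N. w k * exp ((z k)\<^sup>2 * of_real t - z k * of_real r))) \<le> C * exp (- K) / sqrt t)"
    if "1 \<le> K" "0 < \<delta>" "\<delta> < T" and L1: "1 \<le> ln (T / \<delta>)" for K \<delta> T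
  proof -
    define L where "L = ln (T / \<delta>)"
    define h where "h = pi * a / K"
    \<comment> \<open>\<open>exp (L / 2)\<close> is the square root of \<open>T / \<delta>\<close>,
      so \<open>B \<ge> L / 2 + 9\<close> forces \<open>(sinh x)^2 \<ge> 16 * (T / \<delta>)\<close>
      outside the truncation interval; the 9 enters through \<open>exp 9 \<ge> 10\<close>.\<close>
    define N where "N = nat \<lceil>(L / 2 + 9) / h\<rceil>"
    define B where "B = (real N + 1/2) * h"
    define \<mu> where "\<mu> = sqrt (K / T)"
    define Z where "Z = (\<lambda>u::complex. of_real \<mu> * cosh (u + \<i> * of_real \<alpha>))"
    define z where "z = (\<lambda>k::int. Z (of_int k * of_real h))"
    \<comment> \<open>The factor \<open>\<mu> * sinh\<close> is the derivative of the contour; the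
      exact integral is \<open>\<i> * c\<close> times the one-dimensional kernel, and the division
      removes that constant.\<close>
    define w where "w = (\<lambda>k::int. of_real h * (of_real \<mu> * sinh (of_int k * of_real h + \<i> * of_real \<alpha>)) / (\<i> * of_real c))"
    have "h > 0" using a \<open>1 \<le> K\<close> by (simp add: h_def)
    have "\<mu> > 0" using that by (simp add: \<mu>_def)
    have L: "1 \<le> L" using L1 by (simp add: L_def)
    have N_ge: "real N \<ge> (L / 2 + 9) / h" unfolding N_def by linarith
    have "0 < (L / 2 + 9) / h" using L \<open>h > 0\<close> by simp
    then have "N > 0" unfolding N_def by simp
    have "real N \<le> C * K * L"
    proof -
      have "real N \<le> (L / 2 + 9) / h + 1" using \<open>0 < (L / 2 + 9) / h\<close> unfolding N_def by linarith
      also have "(L / 2 + 9) / h \<le> (10 * L) / h" using L \<open>h > 0\<close> by (intro divide_right_mono) auto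
      also have "(10 * L) / h = 10 / (pi * a) * (K * L)" by (simp add: h_def)
      also have "1 \<le> K * L" using L \<open>1 \<le> K\<close> using mult_mono[of 1 K 1 L] by simp
      finally have "real N \<le> (10 / (pi * a) + 1) * (K * L)" by (simp add: distrib_right)
      also have "\<dots> \<le> C * (K * L)"
        unfolding C_def using L \<open>1 \<le> K\<close> \<open>c > 0\<close> a by (intro mult_right_mono) auto
      finally show ?thesis by (simp add: mult.assoc)
    qed
    have B_ge: "L / 2 + 9 \<le> B"
    proof -
      have "L / 2 + 9 \<le> real N * h" using N_ge \<open>h > 0\<close> by (simp add: field_simps)
      also have "\<dots> \<le> B" using \<open>h > 0\<close> by (simp add: B_def)
      finally show ?thesis .
    qed
    have sinh_B: "16 * (T / \<delta>) \<le> (sinh x)\<^sup>2" if "B \<le> \<bar>x\<bar>" for x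
    proof -
      have "10 \<le> exp (9::real)" using exp_ge_add_one_self[of 9] by simp
      have "exp (L / 2) \<ge> 1" using L by simp
      then have "8 * exp (L / 2) \<le> exp (L / 2) * 10 - 1" by linarith
      also have "\<dots> \<le> exp (L / 2) * exp 9 - 1"
        using \<open>10 \<le> exp 9\<close> by (intro diff_right_mono mult_left_mono) auto
      also have "exp (L / 2) * exp 9 = exp (L / 2 + 9)" by (simp add: exp_add)
      also have "exp (L / 2 + 9) - 1 \<le> exp \<bar>x\<bar> - exp (- \<bar>x\<bar>)"
        using B_ge that by (intro diff_mono) auto
      finally have "4 * exp (L / 2) \<le> sinh \<bar>x\<bar>" by (simp add: sinh_field_def)
      then have "(4 * exp (L / 2))\<^sup>2 \<le> (sinh \<bar>x\<bar>)\<^sup>2" by (intro power_mono) auto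
      also have "(4 * exp (L / 2))\<^sup>2 = 16 * exp L" by (simp add: power_mult_distrib flip: exp_double)
      also have "exp L = T / \<delta>" using \<open>0 < \<delta>\<close> \<open>\<delta> < T\<close> by (simp add: L_def)
      also have "(sinh \<bar>x\<bar>)\<^sup>2 = (sinh x)\<^sup>2" by (simp add: abs_if)
      finally show ?thesis .
    qed
    have z_pos: "0 < Re (z k)" for k
    proof -
      have "of_int k * complex_of_real h + \<i> * of_real \<alpha> = Complex (of_int k * h) \<alpha>"
        by (simp add: complex_eq_iff)
      then show ?thesis
        using \<open>\<mu> > 0\<close> cos\<alpha> by (simp add: z_def Z_def cosh_Complex)
    qed
    have error: "cmod (of_real (exp (- (r\<^sup>2) / (4 * t)) / sqrt t)
          - (\<Sum>k=-int N..int N. w k * exp ((z k)\<^sup>2 * of_real t - z k * of_real r))) \<le> C * exp (- K) / sqrt t"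
      if "0 \<le> r" "\<delta> \<le> t" "t \<le> T" for r t
    proof -
      have "t > 0" using that \<open>0 < \<delta>\<close> by simp
      \<comment> \<open>As \<open>v^2 = \<mu>^2 * t / 4\<close>, the exponent of
        \<open>hyperbola_integrand_bound\<close> is \<open>v^2 - 2 * (v * sinh x)^2\<close>. One
        copy of \<open>exp (- (v * sinh x)^2)\<close> is weakened to \<open>1 / q x\<close>, so that
        \<open>p\<close> has an explicit \<open>arctan\<close> antiderivative \<open>P\<close>; the
        other copy is kept for the tail.\<close>
      define v where "v = \<mu> * sqrt t / 2"
      define q where "q = (\<lambda>x. 1 + (v * sinh x)\<^sup>2)"
      define p where "p = (\<lambda>x. \<mu> * cosh x * exp (v\<^sup>2) / q x)"
      define P where "P = (\<lambda>x. 2 * exp (v\<^sup>2) / sqrt t * (arctan (v * sinh x) + pi / 2))"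
      define F where "F = (\<lambda>u. of_real (exp (- (r\<^sup>2) / (4 * t)) / sqrt t) * \<i> *
        G (- \<i> * of_real (sqrt t) * (Z u - of_real (r / (2 * t)))))"
      define f where "f = (\<lambda>u. exp ((Z u)\<^sup>2 * of_real t - Z u * of_real r) * (of_real \<mu> * sinh (u + \<i> * of_real \<alpha>)))"
      have "v > 0" using \<open>\<mu> > 0\<close> \<open>t > 0\<close> by (simp add: v_def)
      have \<mu>_eq: "\<mu> = 2 * v / sqrt t" using \<open>t > 0\<close> by (simp add: v_def)
      have \<mu>t: "\<mu>\<^sup>2 * t = 4 * v\<^sup>2"
        using \<open>t > 0\<close> by (simp add: v_def power_mult_distrib power_divide)
      have v2: "v\<^sup>2 = K / T * t / 4"
        using \<open>t > 0\<close> \<open>1 \<le> K\<close> that by (simp add: v_def \<mu>_def power_mult_distrib power_divide)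
      have "K / T * t \<le> K / T * T" using that \<open>1 \<le> K\<close> \<open>t > 0\<close> by (intro mult_left_mono) auto
      then have "v\<^sup>2 \<le> K / 4" using \<open>t > 0\<close> that v2 by simp
      then have v2_le: "v\<^sup>2 \<le> K" using \<open>1 \<le> K\<close> by simp
      also have "K \<le> K\<^sup>2" using \<open>1 \<le> K\<close> by (simp add: power2_eq_square)
      finally have v_le: "v \<le> K" by (rule power2_le_imp_le) (use \<open>1 \<le> K\<close> in simp)
      have q: "q x > 0" "q x \<le> exp ((v * sinh x)\<^sup>2)" for x
        using exp_ge_add_one_self[of "(v * sinh x)\<^sup>2"] by (simp_all add: q_def add_pos_nonneg)
      have f_Complex: "cmod (f (Complex x y)) \<le> p x * exp (- (v * sinh x)\<^sup>2)" if "\<bar>y\<bar> \<le> a" for x y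
      proof -
        have *: "Complex x y + \<i> * of_real \<alpha> = Complex x (y + \<alpha>)" by (simp add: complex_eq_iff)
        have "cmod (f (Complex x y)) \<le> \<mu> * cosh x * exp (\<mu>\<^sup>2 * t * (1/4 - (sinh x)\<^sup>2 / 2))"
          unfolding f_def Z_def * using \<open>\<mu> > 0\<close> \<open>t > 0\<close> \<open>0 \<le> r\<close> angle[OF that]
          by (intro hyperbola_integrand_bound) auto
        also have "\<mu>\<^sup>2 * t * (1/4 - (sinh x)\<^sup>2 / 2) = v\<^sup>2 + - (v * sinh x)\<^sup>2 + - (v * sinh x)\<^sup>2"
          unfolding \<mu>t by (simp add: power_mult_distrib algebra_simps)
        also have "\<mu> * cosh x * exp (v\<^sup>2 + - (v * sinh x)\<^sup>2 + - (v * sinh x)\<^sup>2)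
            = \<mu> * cosh x * exp (v\<^sup>2) * (1 / exp ((v * sinh x)\<^sup>2)) * exp (- (v * sinh x)\<^sup>2)"
          unfolding exp_add by (simp add: exp_minus divide_inverse)
        also have "\<dots> \<le> \<mu> * cosh x * exp (v\<^sup>2) * (1 / q x) * exp (- (v * sinh x)\<^sup>2)"
          using q[of x] \<open>\<mu> > 0\<close> by (intro mult_right_mono mult_left_mono divide_left_mono) auto
        finally show ?thesis by (simp add: p_def)
      qed
      have p_pos: "p x > 0" for x using q(1)[of x] \<open>\<mu> > 0\<close> by (simp add: p_def)
      have P': "(P has_real_derivative p x) (at x)" for x
      proof -
        have "((\<lambda>x. arctan (v * sinh x) + pi / 2) has_real_derivative inverse (1 + (v * sinh x)\<^sup>2) * (v * cosh x)) (at x)"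
          by (auto intro!: derivative_eq_intros)
        from DERIV_cmult[OF this, of "2 * exp (v\<^sup>2) / sqrt t"]
        have "(P has_real_derivative 2 * exp (v\<^sup>2) / sqrt t * (inverse (1 + (v * sinh x)\<^sup>2) * (v * cosh x))) (at x)"
          unfolding P_def .
        also have "2 * exp (v\<^sup>2) / sqrt t * (inverse (1 + (v * sinh x)\<^sup>2) * (v * cosh x)) = p x"
          unfolding p_def q_def \<mu>_eq by (simp add: divide_inverse mult_ac)
        finally show ?thesis .
      qed
      have P_ge: "0 \<le> P x" for x
        using arctan_lbound[of "v * sinh x"] \<open>t > 0\<close> by (simp add: P_def)
      have P_le: "P x \<le> 2 * pi / sqrt t * exp K" for x
      proof -
        have "P x \<le> 2 * exp K / sqrt t * pi"
          unfolding P_def using arctan_ubound[of "v * sinh x"] arctan_lbound[of "v * sinh x"] v2_le \<open>t > 0\<close>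
          by (intro mult_mono divide_right_mono) auto
        then show ?thesis by (simp add: mult_ac)
      qed
      have p_le: "p x \<le> 2 / sqrt t * exp (3 * K)" for x
      proof -
        have "(cosh x)\<^sup>2 \<le> (1 + \<bar>sinh x\<bar>)\<^sup>2" by (simp add: cosh_square_eq power2_sum)
        then have "cosh x \<le> 1 + \<bar>sinh x\<bar>" by (rule power2_le_imp_le) simp
        then have "v * cosh x \<le> v * (1 + \<bar>sinh x\<bar>)" using \<open>v > 0\<close> by (intro mult_left_mono) auto
        also have "\<dots> \<le> v * 1 + 1 * q x"
        proof -
          have "\<bar>v * sinh x\<bar> \<le> q x"
            using sum_squares_bound[of 1 "\<bar>v * sinh x\<bar>"] by (simp add: q_def)
          then show ?thesis using \<open>v > 0\<close> by (simp add: abs_mult distrib_left)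
        qed
        also have "\<dots> \<le> v * q x + 1 * q x"
          using \<open>v > 0\<close> by (intro add_mono mult_left_mono) (auto simp: q_def)
        also have "\<dots> = (v + 1) * q x" by (simp add: distrib_right)
        also have "\<dots> \<le> exp K * q x"
          using exp_ge_add_one_self[of v] v_le q(1)[of x] by (intro mult_right_mono) (auto intro: order_trans[of _ "exp v"] simp: add.commute)
        finally have "v * cosh x / q x \<le> exp K" using q(1)[of x] by (simp add: divide_le_eq)
        then have "2 / sqrt t * (exp (v\<^sup>2) * (v * cosh x / q x)) \<le> 2 / sqrt t * (exp K * exp K)"
          using v2_le \<open>t > 0\<close> \<open>v > 0\<close> q(1)[of x] by (intro mult_left_mono mult_mono) auto
        also have "exp K * exp K \<le> exp (3 * K)" using \<open>1 \<le> K\<close> by (simp flip: exp_add)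
        also have "2 / sqrt t * (exp (v\<^sup>2) * (v * cosh x / q x)) = p x"
          unfolding p_def \<mu>_eq by (simp add: mult_ac)
        finally show ?thesis using \<open>t > 0\<close> by (simp add: divide_right_mono)
      qed
      have bound: "cmod (f (Complex x y)) \<le> p x" if "\<bar>y\<bar> \<le> a" for x y
      proof -
        have "p x * exp (- (v * sinh x)\<^sup>2) \<le> p x * 1"
          using p_pos[of x] by (intro mult_left_mono) auto
        then show ?thesis using f_Complex[OF that, of x] by simp
      qed
      have tail: "cmod (f (Complex x y)) \<le> exp (- (4 * K)) * p x" if y: "\<bar>y\<bar> \<le> a" and x: "B \<le> \<bar>x\<bar>" for x y
      proof -
        \<comment> \<open>The worst case is \<open>t = \<delta>\<close>, where
          \<open>v^2 = K * \<delta> / (4 * T)\<close>; the factor 16 of \<open>sinh_B\<close> then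
          gives \<open>4 * K\<close>.\<close>
        have "4 * K = (K / T * \<delta> / 4) * (16 * (T / \<delta>))" using \<open>0 < \<delta>\<close> \<open>\<delta> < T\<close> by simp
        also have "\<dots> \<le> v\<^sup>2 * (sinh x)\<^sup>2"
          unfolding v2 using sinh_B[OF x] \<open>1 \<le> K\<close> \<open>0 < \<delta>\<close> \<open>\<delta> < T\<close> \<open>\<delta> \<le> t\<close>
          by (intro mult_mono divide_right_mono mult_left_mono) auto
        finally have "exp (- (v * sinh x)\<^sup>2) \<le> exp (- (4 * K))" by (simp add: power_mult_distrib)
        then have "p x * exp (- (v * sinh x)\<^sup>2) \<le> p x * exp (- (4 * K))"
          using p_pos[of x] by (intro mult_left_mono) auto
        then show ?thesis using f_Complex[OF y, of x] by (simp add: mult.commute)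
      qed
      note hyp = hyperbola_primitive[OF G lim \<open>\<mu> > 0\<close> \<open>t > 0\<close> less_imp_le[OF cos\<alpha>(1)] cos\<alpha>(2) sin\<alpha>, of r]
      have F': "(F has_field_derivative f u) (at u)" for u
        using hyp(1) unfolding F_def f_def Z_def .
      define I where "I = of_real (exp (- (r\<^sup>2) / (4 * t)) / sqrt t) * \<i> * of_real c"
      have F_lim: "(\<lambda>n. F (of_nat n) - F (- of_nat n)) \<longlonglongrightarrow> I"
        using hyp(2) unfolding F_def Z_def I_def \<open>u - l = of_real c\<close> .
      define S where "S = of_real h * (\<Sum>k=-int N..int N. f (of_int k * of_real h))"
      have S: "cmod (S - I) \<le> (6 * (2 * pi / sqrt t) + 6 * a * (2 / sqrt t)) * exp (- K)"
        unfolding S_def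
        by (rule trapezoidal_rule_exponential_error[OF F' a \<open>1 \<le> K\<close> h_def B_def P' P_ge P_le p_le bound tail F_lim])
      have "(\<Sum>k=-int N..int N. w k * exp ((z k)\<^sup>2 * of_real t - z k * of_real r)) = S / (\<i> * of_real c)"
        unfolding S_def sum_distrib_left sum_divide_distrib
        by (intro sum.cong) (auto simp: w_def z_def f_def mult_ac)
      moreover have "of_real (exp (- (r\<^sup>2) / (4 * t)) / sqrt t) = I / (\<i> * of_real c)"
        using \<open>c > 0\<close> by (simp add: I_def)
      ultimately have "cmod (of_real (exp (- (r\<^sup>2) / (4 * t)) / sqrt t)
          - (\<Sum>k=-int N..int N. w k * exp ((z k)\<^sup>2 * of_real t - z k * of_real r))) = cmod (S - I) / c"
        using \<open>c > 0\<close> by (simp add: norm_divide norm_mult norm_minus_commute flip: diff_divide_distrib)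
      also have "\<dots> \<le> (6 * (2 * pi / sqrt t) + 6 * a * (2 / sqrt t)) * exp (- K) / c"
        using S \<open>c > 0\<close> by (intro divide_right_mono) auto
      also have "\<dots> = (12 * pi + 12 * a) / c * (exp (- K) / sqrt t)"
        using \<open>c > 0\<close> \<open>t > 0\<close> by (simp add: field_simps)
      also have "\<dots> \<le> C * (exp (- K) / sqrt t)"
        unfolding C_def using a \<open>t > 0\<close> by (intro mult_right_mono) auto
      finally show ?thesis by simp
    qed
    show ?thesis
      using \<open>N > 0\<close> \<open>real N \<le> C * K * L\<close> z_pos error unfolding L_def by blast
  qed
  then show ?thesis using \<open>C > 0\<close> by blast
qed

section \<open>Negative powers\<close>

text \<open>The right side is a decaying factor, kept for the tails, times a multiple of the
  derivative of a logistic function, which has a bounded antiderivative. For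
  \<open>s \<le> 0\<close> the factor \<open>exp (\<beta> * s)\<close> is split into halves; for
  \<open>s \<ge> 0\<close> the bound \<open>exp s \<ge> s^2 / 2\<close> and a completed square
  absorb even \<open>exp (2 * \<beta> * s)\<close> into \<open>exp (4 * \<beta>^2)\<close>. The
  halved \<open>exp s\<close> on the left leaves room for a cosine as small as \<open>1/2\<close>
  off the real axis.\<close>

lemma exp_double_exp_bound:
  fixes \<beta> s :: real
  assumes "\<beta> > 0"
  shows "exp (\<beta> * s - exp s / 2) \<le>
    exp (- (\<beta> / 2 * \<bar>s\<bar>)) * (4 * exp (4 * \<beta>\<^sup>2) * exp (\<beta> / 2 * s) / (1 + exp (\<beta> / 2 * s))\<^sup>2)"
proof (cases "s \<le> 0")
  case True
  have "\<beta> / 2 * s \<le> 0" using True assms by (simp add: mult_nonneg_nonpos)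
  then have "(1 + exp (\<beta> / 2 * s))\<^sup>2 \<le> 2\<^sup>2" by (intro power_mono) auto
  also have "\<dots> \<le> 4 * exp (4 * \<beta>\<^sup>2)" by simp
  finally have "1 \<le> 4 * exp (4 * \<beta>\<^sup>2) / (1 + exp (\<beta> / 2 * s))\<^sup>2"
    using add_pos_pos[OF zero_less_one exp_gt_zero[of "\<beta> / 2 * s"]] by simp
  then have "exp (\<beta> * s) * 1 \<le> exp (\<beta> * s) * (4 * exp (4 * \<beta>\<^sup>2) / (1 + exp (\<beta> / 2 * s))\<^sup>2)"
    by (intro mult_left_mono) auto
  moreover have "exp (\<beta> * s - exp s / 2) \<le> exp (\<beta> * s)" by simp
  moreover have "exp (\<beta> * s) = exp (- (\<beta> / 2 * \<bar>s\<bar>)) * exp (\<beta> / 2 * s)"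
    using True by (simp flip: exp_add)
  ultimately show ?thesis by (simp add: mult_ac)
next
  case False
  then have s: "0 \<le> s" by simp
  define E where "E = exp (\<beta> / 2 * s)"
  have "E \<ge> 1" using s assms by (simp add: E_def)
  have "s\<^sup>2 / 4 \<le> exp s / 2"
    using exp_lower_Taylor_quadratic[OF s] s by simp
  moreover have "0 \<le> (s / 2 - 2 * \<beta>)\<^sup>2" by simp
  moreover have "(s / 2 - 2 * \<beta>)\<^sup>2 = s\<^sup>2 / 4 - 2 * \<beta> * s + 4 * \<beta>\<^sup>2"
    by (simp add: power2_eq_square algebra_simps)
  ultimately have "2 * \<beta> * s - exp s / 2 \<le> 4 * \<beta>\<^sup>2"
    by linarith
  then have "exp (\<beta> * s - exp s / 2) \<le> exp (4 * \<beta>\<^sup>2 - \<beta> * s)" by simp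
  also have "\<dots> = 4 * exp (4 * \<beta>\<^sup>2) / (E + E)\<^sup>2"
  proof -
    have "E\<^sup>2 = exp (\<beta> * s)" unfolding E_def by (simp flip: exp_double)
    then have "(E + E)\<^sup>2 = 4 * exp (\<beta> * s)" by (simp add: power2_eq_square)
    then show ?thesis by (simp add: exp_diff)
  qed
  also have "\<dots> \<le> 4 * exp (4 * \<beta>\<^sup>2) / (1 + E)\<^sup>2"
    using \<open>E \<ge> 1\<close> by (intro divide_left_mono power_mono) auto
  also have "\<dots> = exp (- (\<beta> / 2 * \<bar>s\<bar>)) * (4 * exp (4 * \<beta>\<^sup>2) * E / (1 + E)\<^sup>2)"
    using s by (simp add: E_def exp_minus)
  finally show ?thesis by (simp only: E_def)
qed

text \<open>Putting \<open>u = s - ln t\<close> turns \<open>exp (\<beta> * u - t * exp u)\<close>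
  into \<open>t powr (- \<beta>) * exp (\<beta> * s - exp s)\<close>: all \<open>t\<close> share one
  integrand up to a factor and a shift by \<open>ln t\<close>, so relative errors are uniform. The
  shifts fill an interval of length \<open>ln (T / \<delta>)\<close>, the decay needs a further
  distance proportional to \<open>K\<close>, and the step is proportional to
  \<open>1 / K\<close>.\<close>

lemma power_exponential_sum:
  fixes \<beta> :: real
  assumes "\<beta> > 0"
  shows "\<exists>C>0. \<forall>K \<delta> T. 1 \<le> K \<and> 0 < \<delta> \<and> \<delta> < T \<and> 1 \<le> ln (T / \<delta>) \<longrightarrow>
    (\<exists>(N::nat) w lam. N > 0 \<and> real N \<le> C * K * (ln (T / \<delta>) + K) \<and> (\<forall>j. 0 < w j \<and> 0 < lam j) \<and>
      (\<forall>t. \<delta> \<le> t \<and> t \<le> T \<longrightarrow>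
        \<bar>t powr (- \<beta>) - (\<Sum>j=1..N. w j * exp (- lam j * t))\<bar> \<le> C * exp (- K) * t powr (- \<beta>)))"
proof -
  define \<gamma> where "\<gamma> = \<beta> / 2"
  define D where "D = 4 * exp (4 * \<beta>\<^sup>2)"
  define b where "b = (\<lambda>s. D * exp (\<gamma> * s) / (1 + exp (\<gamma> * s))\<^sup>2)"
  define Q where "Q = (\<lambda>s. D / \<gamma> * (1 - inverse (1 + exp (\<gamma> * s))))"
  define g :: "complex \<Rightarrow> complex" where "g = (\<lambda>z. exp (of_real \<beta> * z - exp z))"
  define a :: real where "a = pi / 24"
  have a: "0 < a" by (simp add: a_def)
  have "\<gamma> > 0" using assms by (simp add: \<gamma>_def)
  have "D > 0" by (simp add: D_def)
  have pos: "1 + exp (\<gamma> * s) > 0" for s by (simp add: add_pos_pos)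
  have b_bound: "exp (\<beta> * s - exp s / 2) \<le> exp (- (\<gamma> * \<bar>s\<bar>)) * b s" for s
    using exp_double_exp_bound[OF assms, of s] by (simp add: b_def \<gamma>_def D_def)
  have b_pos: "0 < b s" for s using \<open>D > 0\<close> pos[of s] by (simp add: b_def)
  have b_le: "b s \<le> D" for s
  proof -
    have "exp (\<gamma> * s) \<le> (1 + exp (\<gamma> * s))\<^sup>2" by (simp add: power2_sum add_nonneg_nonneg)
    then have "D * exp (\<gamma> * s) \<le> D * (1 + exp (\<gamma> * s))\<^sup>2"
      using \<open>D > 0\<close> by (intro mult_left_mono) auto
    then show ?thesis using pos[of s] by (simp add: b_def divide_le_eq)
  qed
  have Q': "(Q has_real_derivative b s) (at s)" for s
  proof -
    have "((\<lambda>s. 1 - inverse (1 + exp (\<gamma> * s))) has_real_derivative \<gamma> * exp (\<gamma> * s) / (1 + exp (\<gamma> * s))\<^sup>2) (at s)"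
      using pos[of s] by (auto intro!: derivative_eq_intros simp: power2_eq_square field_simps)
    from DERIV_cmult[OF this, of "D / \<gamma>"] show ?thesis
      using \<open>\<gamma> > 0\<close> by (simp add: Q_def b_def)
  qed
  have Q_bounds: "0 \<le> Q s" "Q s \<le> D / \<gamma>" for s
  proof -
    have "inverse (1 + exp (\<gamma> * s)) \<le> 1" "0 \<le> inverse (1 + exp (\<gamma> * s))"
      using pos[of s] by (simp_all add: inverse_le_1_iff)
    then have "0 \<le> D / \<gamma> * (1 - inverse (1 + exp (\<gamma> * s)))" "D / \<gamma> * (1 - inverse (1 + exp (\<gamma> * s))) \<le> D / \<gamma> * 1"
      using \<open>D > 0\<close> \<open>\<gamma> > 0\<close> by (intro mult_nonneg_nonneg mult_left_mono; simp)+
    then show "0 \<le> Q s" "Q s \<le> D / \<gamma>" by (simp_all add: Q_def)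
  qed
  have "g holomorphic_on UNIV" unfolding g_def by (intro holomorphic_intros)
  then obtain G where G: "\<And>z. (G has_field_derivative g z) (at z)"
    using holomorphic_convex_primitive'[of UNIV g] by auto
  have g_real: "g (of_real s) = of_real (exp (\<beta> * s - exp s))" for s
    by (simp add: g_def exp_of_real[symmetric])
  have g_le: "exp (\<beta> * s - exp s) \<le> b s" for s
  proof -
    have "exp (\<beta> * s - exp s) \<le> exp (\<beta> * s - exp s / 2)" by simp
    also have "\<dots> \<le> exp (- (\<gamma> * \<bar>s\<bar>)) * b s" by (rule b_bound)
    also have "\<dots> \<le> 1 * b s" using \<open>\<gamma> > 0\<close> b_pos[of s] by (intro mult_right_mono) auto
    finally show ?thesis by simp
  qed
  have Q_abs: "\<bar>Q s\<bar> \<le> D / \<gamma>" for s using Q_bounds[of s] by simp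
  \<comment> \<open>\<open>c\<close> is the value of the Gamma function at
    \<open>\<beta>\<close>.\<close>
  obtain c u l where "c > 0" and ul: "u - l = complex_of_real c"
    and lim: "((\<lambda>x. G (of_real x)) \<longlongrightarrow> u) at_top" "((\<lambda>x. G (of_real x)) \<longlongrightarrow> l) at_bot"
    by (rule positive_primitive_limits[OF G g_real exp_gt_zero g_le Q' Q_abs]) (rule that)
  \<comment> \<open>The 3 pays for rounding \<open>N\<close> up and for the middle node in
    \<open>2 * N + 1\<close>.\<close>
  define C where "C = (6 * (D / \<gamma>) + 6 * a * D) / c + (1 + 8 / \<gamma>) / (pi * a) + 3"
  have "C > 0"
    unfolding C_def using \<open>c > 0\<close> a \<open>\<gamma> > 0\<close> \<open>D > 0\<close> by (intro add_nonneg_pos add_nonneg_nonneg) auto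
  have "\<exists>(N::nat) w lam. N > 0 \<and> real N \<le> C * K * (ln (T / \<delta>) + K) \<and> (\<forall>j. 0 < w j \<and> 0 < lam j) \<and>
      (\<forall>t. \<delta> \<le> t \<and> t \<le> T \<longrightarrow>
        \<bar>t powr (- \<beta>) - (\<Sum>j=1..N. w j * exp (- lam j * t))\<bar> \<le> C * exp (- K) * t powr (- \<beta>))"
    if "1 \<le> K" "0 < \<delta>" "\<delta> < T" and L1: "1 \<le> ln (T / \<delta>)" for K \<delta> T
  proof -
    define L where "L = ln (T / \<delta>)"
    define h where "h = pi * a / K"
    \<comment> \<open>\<open>L / 2\<close> covers the shifts, and \<open>4 * K / \<gamma>\<close> is
      the distance at which the decay at rate \<open>\<gamma>\<close> reaches
      \<open>exp (- (4 * K))\<close>.\<close>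
    define N where "N = nat \<lceil>(L / 2 + 4 * K / \<gamma>) / h\<rceil>"
    define B where "B = (real N + 1/2) * h"
    \<comment> \<open>Minus the midpoint of \<open>ln \<delta>\<close> and \<open>ln T\<close>: this
      centring keeps \<open>\<sigma> + ln t\<close> within \<open>L / 2\<close> in absolute
      value.\<close>
    define \<sigma> where "\<sigma> = - (ln \<delta> + ln T) / 2"
    define w where "w = (\<lambda>k::int. h * exp (\<beta> * (of_int k * h + \<sigma>)) / c)"
    define lam where "lam = (\<lambda>k::int. exp (of_int k * h + \<sigma>))"
    \<comment> \<open>Matches the numbering \<open>1..2*N+1\<close> with the symmetric range
      \<open>-N..N\<close>.\<close>
    define k where "k = (\<lambda>j::nat. int j - int N - 1)"
    have "h > 0" using a \<open>1 \<le> K\<close> by (simp add: h_def)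
    have L: "1 \<le> L" using L1 by (simp add: L_def)
    have L_eq: "L = ln T - ln \<delta>" using that by (simp add: L_def ln_div)
    have N_ge: "real N \<ge> (L / 2 + 4 * K / \<gamma>) / h" unfolding N_def by linarith
    have ratio: "0 < (L / 2 + 4 * K / \<gamma>) / h"
      using L \<open>h > 0\<close> \<open>1 \<le> K\<close> \<open>\<gamma> > 0\<close> by (intro divide_pos_pos add_pos_pos) auto
    have "real (2 * N + 1) \<le> C * K * (L + K)"
    proof -
      have "real N \<le> (L / 2 + 4 * K / \<gamma>) / h + 1" using ratio unfolding N_def by linarith
      moreover have "real (2 * N + 1) = 2 * real N + 1" by simp
      ultimately have "real (2 * N + 1) \<le> 2 * ((L / 2 + 4 * K / \<gamma>) / h) + 3" by linarith
      also have "2 * ((L / 2 + 4 * K / \<gamma>) / h) = (1 * L + 8 / \<gamma> * K) * (K / (pi * a))"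
      proof -
        have "(L / 2 + 4 * K / \<gamma>) / h = (L / 2 + 4 * K / \<gamma>) * (K / (pi * a))" by (simp add: h_def)
        moreover have "2 * (L / 2 + 4 * K / \<gamma>) = 1 * L + 8 / \<gamma> * K" by simp
        ultimately show ?thesis by (metis mult.assoc)
      qed
      also have "\<dots> \<le> ((1 + 8 / \<gamma>) * (L + K)) * (K / (pi * a))"
      proof (rule mult_right_mono)
        have "0 \<le> 8 / \<gamma> * L" using L \<open>\<gamma> > 0\<close> by simp
        then show "1 * L + 8 / \<gamma> * K \<le> (1 + 8 / \<gamma>) * (L + K)"
          unfolding distrib_right distrib_left using \<open>1 \<le> K\<close> by linarith
      qed (use \<open>1 \<le> K\<close> a in simp)
      also have "\<dots> = (1 + 8 / \<gamma>) / (pi * a) * (K * (L + K))" by simp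
      finally have "real (2 * N + 1) \<le> (1 + 8 / \<gamma>) / (pi * a) * (K * (L + K)) + 3" by simp
      moreover have "1 \<le> K * (L + K)" using L \<open>1 \<le> K\<close> mult_mono[of 1 K 1 "L + K"] by simp
      ultimately have "real (2 * N + 1) \<le> ((1 + 8 / \<gamma>) / (pi * a) + 3) * (K * (L + K))"
        unfolding distrib_right[of _ 3] by linarith
      also have "\<dots> \<le> C * (K * (L + K))"
        unfolding C_def using L \<open>1 \<le> K\<close> \<open>c > 0\<close> a \<open>\<gamma> > 0\<close> \<open>D > 0\<close> by (intro mult_right_mono) auto
      finally show ?thesis by (simp only: mult.assoc)
    qed
    moreover have B_ge: "L / 2 + 4 * K / \<gamma> \<le> B"
    proof -
      have "L / 2 + 4 * K / \<gamma> \<le> real N * h" using N_ge \<open>h > 0\<close> by (simp add: pos_divide_le_eq)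
      also have "\<dots> \<le> B" using \<open>h > 0\<close> by (simp add: B_def)
      finally show ?thesis .
    qed
    moreover have "0 < w i \<and> 0 < lam i" for i
      using \<open>h > 0\<close> \<open>c > 0\<close> by (simp add: w_def lam_def)
    moreover have "\<bar>t powr (- \<beta>) - (\<Sum>j=1..2*N+1. w (k j) * exp (- lam (k j) * t))\<bar> \<le> C * exp (- K) * t powr (- \<beta>)"
      if "\<delta> \<le> t" "t \<le> T" for t
    proof -
      have "t > 0" using that \<open>0 < \<delta>\<close> by simp
      define m where "m = t powr (- \<beta>)"
      define \<tau> where "\<tau> = \<sigma> + ln t"
      define F where "F = (\<lambda>z. of_real m * G (z + of_real \<tau>))"
      define f where "f = (\<lambda>z. of_real m * g (z + of_real \<tau>))"
      have "m > 0" using \<open>t > 0\<close> by (simp add: m_def)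
      have "ln \<delta> \<le> ln t" "ln t \<le> ln T" using that \<open>0 < \<delta>\<close> \<open>t > 0\<close> by simp_all
      then have \<tau>: "\<bar>\<tau>\<bar> \<le> L / 2" unfolding \<tau>_def \<sigma>_def L_eq by (intro abs_leI) (simp_all add: field_simps)
      have F': "(F has_field_derivative f z) (at z)" for z
        unfolding F_def f_def by (intro DERIV_cmult DERIV_shift[THEN iffD1, OF G])
      have f_Complex: "cmod (f (Complex x y)) \<le> m * (exp (- (\<gamma> * \<bar>x + \<tau>\<bar>)) * b (x + \<tau>))" if "\<bar>y\<bar> \<le> a" for x y
      proof -
        \<comment> \<open>\<open>exp (Complex x y)\<close> has real part
          \<open>exp x * cos y\<close>, so a cosine of at least \<open>1/2\<close> reduces the
          modulus to the left side of \<open>b_bound\<close>.\<close>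
        have "cos (pi / 3) \<le> cos \<bar>y\<bar>"
          using that pi_gt_zero by (intro cos_monotone_0_pi_le) (auto simp: a_def)
        then have "cos y \<ge> 1/2" by (simp add: cos_60)
        then have "exp (x + \<tau>) * (1/2) \<le> exp (x + \<tau>) * cos y" by (intro mult_left_mono) auto
        then have "exp (\<beta> * (x + \<tau>) - exp (x + \<tau>) * cos y) \<le> exp (\<beta> * (x + \<tau>) - exp (x + \<tau>) / 2)" by simp
        also note b_bound
        finally have "m * exp (\<beta> * (x + \<tau>) - exp (x + \<tau>) * cos y) \<le> m * (exp (- (\<gamma> * \<bar>x + \<tau>\<bar>)) * b (x + \<tau>))"
          using \<open>m > 0\<close> by (intro mult_left_mono) auto
        moreover have "cmod (f (Complex x y)) = m * exp (\<beta> * (x + \<tau>) - exp (x + \<tau>) * cos y)"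
          using \<open>m > 0\<close> by (simp add: f_def g_def norm_mult Re_exp)
        ultimately show ?thesis by simp
      qed
      have bound: "cmod (f (Complex x y)) \<le> m * b (x + \<tau>)" if "\<bar>y\<bar> \<le> a" for x y
      proof -
        have "exp (- (\<gamma> * \<bar>x + \<tau>\<bar>)) * b (x + \<tau>) \<le> 1 * b (x + \<tau>)"
          using \<open>\<gamma> > 0\<close> b_pos[of "x + \<tau>"] by (intro mult_right_mono) auto
        then have "m * (exp (- (\<gamma> * \<bar>x + \<tau>\<bar>)) * b (x + \<tau>)) \<le> m * b (x + \<tau>)"
          using \<open>m > 0\<close> by simp
        then show ?thesis using f_Complex[OF that, of x] by linarith
      qed
      have tail: "cmod (f (Complex x y)) \<le> exp (- (4 * K)) * (m * b (x + \<tau>))" if y: "\<bar>y\<bar> \<le> a" and x: "B \<le> \<bar>x\<bar>" for x y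
      proof -
        have "4 * K / \<gamma> \<le> \<bar>x + \<tau>\<bar>" using x B_ge \<tau> by linarith
        then have "4 * K \<le> \<gamma> * \<bar>x + \<tau>\<bar>" using \<open>\<gamma> > 0\<close> by (simp add: pos_divide_le_eq mult.commute)
        then have "m * (exp (- (\<gamma> * \<bar>x + \<tau>\<bar>)) * b (x + \<tau>)) \<le> m * (exp (- (4 * K)) * b (x + \<tau>))"
          using \<open>m > 0\<close> b_pos[of "x + \<tau>"] by (intro mult_left_mono mult_right_mono) auto
        then show ?thesis using f_Complex[OF y, of x] by (simp add: mult_ac)
      qed
      have P': "((\<lambda>x. m * Q (x + \<tau>)) has_real_derivative m * b (x + \<tau>)) (at x)" for x
        by (intro DERIV_cmult DERIV_shift[THEN iffD1, OF Q'])
      have P_ge: "0 \<le> m * Q (x + \<tau>)" for x using Q_bounds \<open>m > 0\<close> by simp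
      have P_le: "m * Q (x + \<tau>) \<le> m * (D / \<gamma>) * exp K" for x
      proof -
        have "m * Q (x + \<tau>) * 1 \<le> m * (D / \<gamma>) * exp K"
          using Q_bounds[of "x + \<tau>"] \<open>m > 0\<close> \<open>1 \<le> K\<close> \<open>D > 0\<close> \<open>\<gamma> > 0\<close> by (intro mult_mono mult_left_mono) auto
        then show ?thesis by simp
      qed
      have p_le: "m * b (x + \<tau>) \<le> m * D * exp (3 * K)" for x
      proof -
        have "m * b (x + \<tau>) * 1 \<le> m * D * exp (3 * K)"
          using b_le[of "x + \<tau>"] b_pos[of "x + \<tau>"] \<open>m > 0\<close> \<open>1 \<le> K\<close> \<open>D > 0\<close> by (intro mult_mono mult_left_mono) auto
        then show ?thesis by simp
      qed
      have F_lim: "(\<lambda>n. F (of_nat n) - F (- of_nat n)) \<longlonglongrightarrow> of_real m * of_real c"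
      proof -
        have "filterlim (\<lambda>n. real n + \<tau>) at_top sequentially" "filterlim (\<lambda>n. - real n + \<tau>) at_bot sequentially"
          by real_asymp+
        then have "(\<lambda>n. of_real m * (G (of_real (real n + \<tau>)) - G (of_real (- real n + \<tau>)))) \<longlonglongrightarrow> of_real m * (u - l)"
          by (intro tendsto_intros filterlim_compose[OF lim(1)] filterlim_compose[OF lim(2)])
        then show ?thesis by (simp add: F_def ul right_diff_distrib)
      qed
      define S where "S = h * (\<Sum>i=-int N..int N. m * exp (\<beta> * (of_int i * h + \<tau>) - exp (of_int i * h + \<tau>)))"
      have "f (of_int i * of_real h) = of_real (m * exp (\<beta> * (of_int i * h + \<tau>) - exp (of_int i * h + \<tau>)))" for i
        using g_real[of "of_int i * h + \<tau>"] by (simp add: f_def)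
      then have S_eq: "of_real h * (\<Sum>i=-int N..int N. f (of_int i * of_real h)) = of_real S"
        by (simp add: S_def)
      have "cmod (of_real S - of_real m * of_real c) \<le> (6 * (m * (D / \<gamma>)) + 6 * a * (m * D)) * exp (- K)"
        unfolding S_eq[symmetric]
        by (rule trapezoidal_rule_exponential_error[OF F' a \<open>1 \<le> K\<close> h_def B_def P' P_ge P_le p_le bound tail F_lim])
      then have S: "\<bar>S - m * c\<bar> \<le> (6 * (m * (D / \<gamma>)) + 6 * a * (m * D)) * exp (- K)"
        by (simp only: of_real_mult[symmetric] of_real_diff[symmetric] norm_of_real)
      have "(\<Sum>j=1..2*N+1. w (k j) * exp (- lam (k j) * t)) = (\<Sum>i=-int N..int N. w i * exp (- lam i * t))"
        by (rule sum.reindex_bij_witness[of _ "\<lambda>i. nat (i + int N + 1)" k]) (auto simp: k_def)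
      also have "\<dots> = S / c"
        unfolding S_def sum_distrib_left sum_divide_distrib
      proof (intro sum.cong refl)
        fix i
        have "exp (of_int i * h + \<tau>) = lam i * t"
          using \<open>t > 0\<close> by (simp add: \<tau>_def lam_def exp_add)
        \<comment> \<open>The factor \<open>m\<close> cancels the \<open>ln t\<close> in the shift,
          so the weights do not depend on \<open>t\<close>.\<close>
        moreover have "m * exp (\<beta> * (of_int i * h + \<tau>)) = exp (\<beta> * (of_int i * h + \<sigma>))"
          using \<open>t > 0\<close> by (simp add: m_def \<tau>_def powr_def algebra_simps flip: exp_add)
        ultimately show "w i * exp (- lam i * t) = h * (m * exp (\<beta> * (of_int i * h + \<tau>) - exp (of_int i * h + \<tau>))) / c"
          by (simp add: w_def exp_diff exp_minus divide_inverse)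
      qed
      finally have "t powr (- \<beta>) - (\<Sum>j=1..2*N+1. w (k j) * exp (- lam (k j) * t)) = - (S - m * c) / c"
        using \<open>c > 0\<close> by (simp add: m_def field_simps)
      then have "\<bar>t powr (- \<beta>) - (\<Sum>j=1..2*N+1. w (k j) * exp (- lam (k j) * t))\<bar> = \<bar>S - m * c\<bar> / c"
        using \<open>c > 0\<close> by simp
      also have "\<dots> \<le> (6 * (m * (D / \<gamma>)) + 6 * a * (m * D)) * exp (- K) / c"
        using S \<open>c > 0\<close> by (intro divide_right_mono) auto
      also have "\<dots> = (6 * (D / \<gamma>) + 6 * a * D) / c * (exp (- K) * m)"
        using \<open>c > 0\<close> \<open>\<gamma> > 0\<close> by (simp add: field_simps)
      also have "\<dots> \<le> C * (exp (- K) * m)"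
        unfolding C_def using \<open>m > 0\<close> a \<open>\<gamma> > 0\<close> by (intro mult_right_mono) auto
      finally show ?thesis by (simp add: m_def mult.assoc)
    qed
    ultimately show ?thesis
      unfolding L_def
      by (intro exI[of _ "2 * N + 1"] exI[of _ "\<lambda>j. w (k j)"] exI[of _ "\<lambda>j. lam (k j)"]) auto
  qed
  then show ?thesis using \<open>C > 0\<close> by blast
qed

section \<open>The heat kernel in dimension at least two\<close>

lemma square_not_nonpos_real:
  assumes "0 < Re z"
  shows "z\<^sup>2 \<notin> complex_of_real ` {..0}"
proof
  assume "z\<^sup>2 \<in> complex_of_real ` {..0}"
  then have "Im (z\<^sup>2) = 0" "Re (z\<^sup>2) \<le> 0" by auto
  then have "Im z = 0" "(Re z)\<^sup>2 \<le> (Im z)\<^sup>2"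
    using assms by (auto simp: Im_power2 Re_power2)
  then show False using assms by simp
qed

text \<open>Uses \<open>a * b - a' * b' = a * (b - b') + (a - a') * b'\<close>; since
  \<open>\<eta> \<le> 1\<close>, the approximant \<open>b'\<close> is at most
  \<open>(1 + C2) * B\<close>, which produces the cross term \<open>C1 * C2\<close>.\<close>

lemma norm_mult_diff_le:
  fixes a a' b b' :: "'a::real_normed_algebra"
  assumes "norm (a - a') \<le> C1 * \<eta> * A" "norm (b - b') \<le> C2 * \<eta> * B" "norm a \<le> A" "norm b \<le> B"
    and "0 \<le> C1" "0 \<le> C2" "0 \<le> \<eta>" "\<eta> \<le> 1"
  shows "norm (a * b - a' * b') \<le> (C1 + C2 + C1 * C2) * \<eta> * (A * B)"
proof -
  have A: "0 \<le> A" and B: "0 \<le> B"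
    using assms(3,4) norm_ge_zero order_trans by blast+
  have "norm b' \<le> norm b + norm (b - b')"
    using norm_triangle_ineq4[of b "b - b'"] by simp
  also have "\<dots> \<le> B + C2 * 1 * B"
    using assms B by (intro add_mono order_trans[OF assms(2)] mult_right_mono mult_left_mono) auto
  finally have b': "norm b' \<le> (1 + C2) * B" by (simp add: algebra_simps)
  have "a * b - a' * b' = a * (b - b') + (a - a') * b'" by (simp add: algebra_simps)
  then have "norm (a * b - a' * b') \<le> norm a * norm (b - b') + norm (a - a') * norm b'"
    using norm_triangle_le[OF add_mono[OF norm_mult_ineq norm_mult_ineq]] by metis
  also have "\<dots> \<le> A * (C2 * \<eta> * B) + C1 * \<eta> * A * ((1 + C2) * B)"
    using assms A B b' by (intro add_mono mult_mono) auto
  finally show ?thesis by (simp add: algebra_simps)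
qed

theorem theorem2:
  assumes "DIM('a::euclidean_space) \<ge> 2"
  shows "\<exists>C>0. \<forall>\<epsilon> T \<delta>. 0 < \<epsilon> \<and> \<epsilon> < 0.1 \<and> 0 < \<delta> \<and> 1000 * \<delta> \<le> T \<longrightarrow>
    (\<exists>(N1::nat) (N2::nat) (wt::nat \<Rightarrow> real) (lam::nat \<Rightarrow> real) (w::int \<Rightarrow> complex) (s::int \<Rightarrow> complex).
       N1 > 0 \<and> N2 > 0 \<and>
       real N1 \<le> C * ln (T / \<delta>) * (ln (1 / \<epsilon>) + ln (ln (T / \<delta>))) \<and>
       real N2 \<le> C * ln (1 / \<epsilon>) * (ln (T / \<delta>) + ln (1 / \<epsilon>)) \<and>
       (\<forall>j\<in>{1..N2}. wt j > 0 \<and> lam j > 0) \<and>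
       (\<forall>k\<in>{-int N1..int N1}. s k \<notin> complex_of_real ` {..0}) \<and>
       (\<forall>(x::'a) t. \<delta> \<le> t \<and> t \<le> T \<longrightarrow>
          cmod (complex_of_real (heat_kernel x t) - approx_kernel N1 N2 wt lam w s x t)
            < \<epsilon> / t powr (real DIM('a) / 2)))"
proof -
  define d where "d = real DIM('a)"
  \<comment> \<open>One factor \<open>t powr (- 1/2)\<close> of \<open>t powr (- d/2)\<close> goes
    to the one-dimensional kernel; \<open>\<beta>\<close> is the exponent that remains.\<close>
  define \<beta> where "\<beta> = (d - 1) / 2"
  have "d \<ge> 2" using assms by (simp add: d_def)
  then have "\<beta> > 0" by (simp add: \<beta>_def)
  obtain C1 where "C1 > 0" and gauss: "\<forall>K \<delta> T. 1 \<le> K \<and> 0 < \<delta> \<and> \<delta> < T \<and> 1 \<le> ln (T / \<delta>) \<longrightarrow>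
    (\<exists>(N::nat) w z. N > 0 \<and> real N \<le> C1 * K * ln (T / \<delta>) \<and> (\<forall>k::int. 0 < Re (z k)) \<and>
      (\<forall>r t. 0 \<le> r \<and> \<delta> \<le> t \<and> t \<le> T \<longrightarrow>
        cmod (of_real (exp (- (r\<^sup>2) / (4 * t)) / sqrt t)
          - (\<Sum>k=-int N..int N. w k * exp ((z k)\<^sup>2 * of_real t - z k * of_real r))) \<le> C1 * exp (- K) / sqrt t))"
    using gaussian_exponential_sum by (elim exE conjE) (rule that)
  obtain C2 where "C2 > 0" and power: "\<forall>K \<delta> T. 1 \<le> K \<and> 0 < \<delta> \<and> \<delta> < T \<and> 1 \<le> ln (T / \<delta>) \<longrightarrow>
    (\<exists>(N::nat) w lam. N > 0 \<and> real N \<le> C2 * K * (ln (T / \<delta>) + K) \<and> (\<forall>j. 0 < w j \<and> 0 < lam j) \<and>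
      (\<forall>t. \<delta> \<le> t \<and> t \<le> T \<longrightarrow>
        \<bar>t powr (- \<beta>) - (\<Sum>j=1..N. w j * exp (- lam j * t))\<bar> \<le> C2 * exp (- K) * t powr (- \<beta>)))"
    using power_exponential_sum[OF \<open>\<beta> > 0\<close>] by (elim exE conjE) (rule that)
  define M where "M = C2 + C1 + C2 * C1"
  \<comment> \<open>With \<open>K = ln (1 / \<epsilon>) + \<kappa>\<close> this choice gives
    \<open>M * exp (- K) = \<epsilon> * exp (- 1) * M / (1 + M)\<close>, strictly below
    \<open>\<epsilon>\<close>.\<close>
  define \<kappa> where "\<kappa> = ln (1 + M) + 1"
  \<comment> \<open>Since \<open>K \<le> (1 + \<kappa>) * ln (1 / \<epsilon>)\<close>, each
    occurrence of \<open>K\<close> costs a factor \<open>1 + \<kappa>\<close>: one in the bound for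
    \<open>N1\<close>, two in that for \<open>N2\<close>.\<close>
  define C where "C = C1 * (1 + \<kappa>) + C2 * (1 + \<kappa>)\<^sup>2"
  have "M > 0" using \<open>C1 > 0\<close> \<open>C2 > 0\<close> by (simp add: M_def add_pos_pos)
  then have "\<kappa> \<ge> 1" by (simp add: \<kappa>_def)
  have C: "C1 * (1 + \<kappa>) \<le> C" "C2 * (1 + \<kappa>)\<^sup>2 \<le> C" "C > 0"
    using \<open>C1 > 0\<close> \<open>C2 > 0\<close> \<open>\<kappa> \<ge> 1\<close> by (auto simp: C_def intro!: add_pos_pos)
  have "\<exists>(N1::nat) (N2::nat) (wt::nat \<Rightarrow> real) (lam::nat \<Rightarrow> real) (w::int \<Rightarrow> complex) (s::int \<Rightarrow> complex).
       N1 > 0 \<and> N2 > 0 \<and>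
       real N1 \<le> C * ln (T / \<delta>) * (ln (1 / \<epsilon>) + ln (ln (T / \<delta>))) \<and>
       real N2 \<le> C * ln (1 / \<epsilon>) * (ln (T / \<delta>) + ln (1 / \<epsilon>)) \<and>
       (\<forall>j\<in>{1..N2}. wt j > 0 \<and> lam j > 0) \<and>
       (\<forall>k\<in>{-int N1..int N1}. s k \<notin> complex_of_real ` {..0}) \<and>
       (\<forall>(x::'a) t. \<delta> \<le> t \<and> t \<le> T \<longrightarrow>
          cmod (complex_of_real (heat_kernel x t) - approx_kernel N1 N2 wt lam w s x t)
            < \<epsilon> / t powr (real DIM('a) / 2))"
    if "0 < \<epsilon>" "\<epsilon> < 0.1" "0 < \<delta>" "1000 * \<delta> \<le> T" for \<epsilon> T \<delta> :: real
  proof -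
    define l where "l = ln (1 / \<epsilon>)"
    define L where "L = ln (T / \<delta>)"
    define K where "K = l + \<kappa>"
    have exp1: "exp 1 \<le> (3::real)" by (rule exp_le)
    have "10 \<le> 1 / \<epsilon>" using that by (simp add: pos_le_divide_eq)
    then have "exp 1 \<le> 1 / \<epsilon>" using exp1 by linarith
    then have l: "l \<ge> 1" using that by (simp add: l_def ln_ge_iff)
    have "1000 \<le> T / \<delta>" using that by (simp add: pos_le_divide_eq)
    then have "exp 1 \<le> T / \<delta>" using exp1 by linarith
    then have L: "L \<ge> 1" using that by (simp add: L_def ln_ge_iff)
    have "\<delta> < T" using that by simp
    have "K \<ge> 1" using l \<open>\<kappa> \<ge> 1\<close> by (simp add: K_def)
    have K_le: "K \<le> (1 + \<kappa>) * l"
      using l \<open>\<kappa> \<ge> 1\<close> mult_left_mono[of 1 l \<kappa>] by (simp add: K_def distrib_right)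
    obtain N1 :: nat and w z where N1: "N1 > 0" "real N1 \<le> C1 * K * L" and z: "\<And>k. 0 < Re (z k)"
      and w: "\<And>r t. 0 \<le> r \<Longrightarrow> \<delta> \<le> t \<Longrightarrow> t \<le> T \<Longrightarrow> cmod (of_real (exp (- (r\<^sup>2) / (4 * t)) / sqrt t)
          - (\<Sum>k=-int N1..int N1. w k * exp ((z k)\<^sup>2 * of_real t - z k * of_real r))) \<le> C1 * exp (- K) / sqrt t"
      using gauss[rule_format, OF conjI[OF \<open>K \<ge> 1\<close> conjI[OF \<open>0 < \<delta>\<close> conjI[OF \<open>\<delta> < T\<close> L[unfolded L_def]]]]] unfolding L_def by blast
    obtain N2 :: nat and wt lam where N2: "N2 > 0" "real N2 \<le> C2 * K * (L + K)"
      and wt: "\<And>j. 0 < wt j" "\<And>j. 0 < lam j"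
      and F: "\<And>t. \<delta> \<le> t \<Longrightarrow> t \<le> T \<Longrightarrow>
        \<bar>t powr (- \<beta>) - (\<Sum>j=1..N2. wt j * exp (- lam j * t))\<bar> \<le> C2 * exp (- K) * t powr (- \<beta>)"
      using power[rule_format, OF conjI[OF \<open>K \<ge> 1\<close> conjI[OF \<open>0 < \<delta>\<close> conjI[OF \<open>\<delta> < T\<close> L[unfolded L_def]]]]] unfolding L_def by blast
    \<comment> \<open>This constant of the heat kernel is put into the weights \<open>w\<close>;
      being at most 1, it does not increase the error.\<close>
    define c0 where "c0 = (4 * pi) powr (- d / 2)"
    have c0: "0 < c0" "c0 \<le> 1"
    proof -
      show "0 < c0" by (simp add: c0_def)
      have "(4 * pi) powr (- d / 2) \<le> (4 * pi) powr 0"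
        using pi_gt3 \<open>d \<ge> 2\<close> by (intro powr_mono) auto
      then show "c0 \<le> 1" by (simp add: c0_def)
    qed
    have N1_le: "real N1 \<le> C * L * (l + ln L)"
    proof -
      have "real N1 \<le> C1 * ((1 + \<kappa>) * l) * L"
        using \<open>C1 > 0\<close> K_le L by (intro order_trans[OF N1(2)] mult_right_mono mult_left_mono) auto
      also have "\<dots> = C1 * (1 + \<kappa>) * (L * l)" by simp
      \<comment> \<open>Enlarging \<open>l\<close> to \<open>l + ln L\<close> is allowed because
        \<open>L \<ge> 1\<close>.\<close>
      also have "\<dots> \<le> C * (L * (l + ln L))"
        using C L l by (intro mult_mono mult_left_mono) auto
      finally show ?thesis by (simp only: mult.assoc)
    qed
    have N2_le: "real N2 \<le> C * l * (L + l)"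
    proof -
      have "L + K \<le> (1 + \<kappa>) * L + (1 + \<kappa>) * l"
        using K_le L \<open>\<kappa> \<ge> 1\<close> mult_right_mono[of 1 "1 + \<kappa>" L] by linarith
      then have "C2 * K * (L + K) \<le> C2 * ((1 + \<kappa>) * l) * ((1 + \<kappa>) * L + (1 + \<kappa>) * l)"
        using \<open>C2 > 0\<close> K_le L l \<open>K \<ge> 1\<close> by (intro mult_mono mult_left_mono) auto
      also have "\<dots> = C2 * (1 + \<kappa>)\<^sup>2 * (l * (L + l))"
        by (simp add: power2_eq_square algebra_simps)
      also have "\<dots> \<le> C * (l * (L + l))"
        using C L l by (intro mult_right_mono) auto
      finally show ?thesis using N2(2) by (simp only: mult.assoc)
    qed
    have error: "cmod (complex_of_real (heat_kernel x t)
        - approx_kernel N1 N2 wt lam (\<lambda>k. of_real c0 * w k) (\<lambda>k. (z k)\<^sup>2) x t) < \<epsilon> / t powr (real DIM('a) / 2)"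
      if "\<delta> \<le> t" "t \<le> T" for x :: 'a and t
    proof -
      have "t > 0" using that \<open>0 < \<delta>\<close> by simp
      define A where "A = t powr (- \<beta>)"
      define S where "S = (\<Sum>j=1..N2. wt j * exp (- lam j * t))"
      define b where "b = exp (- ((norm x)\<^sup>2) / (4 * t)) / sqrt t"
      define H where "H = (\<Sum>k=-int N1..int N1. w k * exp ((z k)\<^sup>2 * of_real t - z k * of_real (norm x)))"
      have scale: "A * (1 / sqrt t) = t powr (- d / 2)"
        using \<open>t > 0\<close> by (simp add: A_def \<beta>_def powr_half_sqrt[symmetric] powr_minus_divide powr_diff diff_divide_distrib powr_add[symmetric] flip: powr_diff)
      have kernel: "heat_kernel x t = c0 * (A * b)"
      proof -
        have "heat_kernel x t = exp (- ((norm x)\<^sup>2) / (4 * t)) * (c0 * t powr (- d / 2))"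
          using \<open>t > 0\<close> by (simp add: heat_kernel_def c0_def d_def powr_mult powr_minus_divide)
        then show ?thesis unfolding scale[symmetric] by (simp add: b_def)
      qed
      \<comment> \<open>As \<open>Re (z k) > 0\<close>, the principal root of \<open>(z k)^2\<close>
        is \<open>z k\<close>, so \<open>s k = (z k)^2\<close> reproduces the terms of
        \<open>H\<close>.\<close>
      have "exp ((z k)\<^sup>2 * of_real t) * exp (- csqrt ((z k)\<^sup>2) * of_real (norm x))
          = exp ((z k)\<^sup>2 * of_real t - z k * of_real (norm x))" for k
        using z[of k] by (simp add: csqrt_square mult_exp_exp)
      then have approx: "approx_kernel N1 N2 wt lam (\<lambda>k. of_real c0 * w k) (\<lambda>k. (z k)\<^sup>2) x t = of_real c0 * (of_real S * H)"
        unfolding approx_kernel_def sum_distrib_right[symmetric]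
        by (simp add: S_def H_def sum_distrib_left mult.assoc mult.left_commute)
      have "cmod (of_real A * of_real b - of_real S * H) \<le> (C2 + C1 + C2 * C1) * exp (- K) * (A * (1 / sqrt t))"
      proof (rule norm_mult_diff_le)
        have "cmod (of_real A - of_real S) = \<bar>A - S\<bar>"
          by (simp only: of_real_diff[symmetric] norm_of_real)
        then show "cmod (of_real A - of_real S) \<le> C2 * exp (- K) * A"
          using F[OF that] by (simp add: A_def S_def)
        show "cmod (of_real b - H) \<le> C1 * exp (- K) * (1 / sqrt t)"
          using w[OF norm_ge_zero that] by (simp add: b_def H_def)
        show "cmod (of_real b) \<le> 1 / sqrt t"
          using \<open>t > 0\<close> by (simp add: b_def norm_divide divide_right_mono)
      qed (use \<open>C1 > 0\<close> \<open>C2 > 0\<close> \<open>K \<ge> 1\<close> in \<open>auto simp: A_def\<close>)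
      also have "\<dots> = M * exp (- K) * t powr (- d / 2)" by (simp only: scale M_def)
      also have "\<dots> < \<epsilon> * t powr (- d / 2)"
      proof -
        have "exp (- K) = \<epsilon> * exp (- 1) / (1 + M)"
          using \<open>0 < \<epsilon>\<close> \<open>M > 0\<close> by (simp add: K_def \<kappa>_def l_def exp_diff exp_add exp_minus ln_div field_simps)
        then have "M * exp (- K) = \<epsilon> * (exp (- 1) * (M / (1 + M)))" by simp
        also have "\<dots> < \<epsilon> * (1 * 1)"
          using \<open>0 < \<epsilon>\<close> \<open>M > 0\<close> by (intro mult_strict_left_mono mult_strict_mono) auto
        finally show ?thesis using \<open>t > 0\<close> by (intro mult_strict_right_mono) auto
      qed
      finally have *: "cmod (of_real A * of_real b - of_real S * H) < \<epsilon> * t powr (- d / 2)" .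
      have "cmod (complex_of_real (heat_kernel x t)
          - approx_kernel N1 N2 wt lam (\<lambda>k. of_real c0 * w k) (\<lambda>k. (z k)\<^sup>2) x t)
          = c0 * cmod (of_real A * of_real b - of_real S * H)"
      proof -
        have "complex_of_real (heat_kernel x t)
          - approx_kernel N1 N2 wt lam (\<lambda>k. of_real c0 * w k) (\<lambda>k. (z k)\<^sup>2) x t
          = of_real c0 * (of_real A * of_real b - of_real S * H)"
          unfolding kernel approx by (simp add: right_diff_distrib)
        then show ?thesis using c0 by (simp only: norm_mult) simp
      qed
      also have "\<dots> \<le> 1 * cmod (of_real A * of_real b - of_real S * H)"
        using c0 by (intro mult_right_mono) auto
      also have "\<dots> < \<epsilon> / t powr (real DIM('a) / 2)"
        using * \<open>t > 0\<close> by (simp add: d_def powr_minus_divide)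
      finally show ?thesis .
    qed
    show ?thesis
      using N1(1) N2(1) N1_le N2_le wt error square_not_nonpos_real[OF z]
      unfolding l_def L_def
      by - (rule exI[of _ N1], rule exI[of _ N2], rule exI[of _ wt], rule exI[of _ lam],
          rule exI[of _ "\<lambda>k. of_real c0 * w k"], rule exI[of _ "\<lambda>k. (z k)\<^sup>2"], blast)
  qed
  then show ?thesis using \<open>C > 0\<close> by blast
qed

end
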